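(* For any $1/2\le p_1<p_2\le 1$ there exists a coupling of $T_\infty(p_1)$ and $T_\infty(p_2)$ (that is, random trees $T_\infty(p_1)\sim \mathcal{T}_\infty(p_1)$ and $T_\infty(p_2)\sim\mathcal{T}_\infty(p_2)$ defined on a common probability space) such that $$\mathbb{P}\big(T_\infty(p_1)\subseteq T_\infty(p_2)\big)=1.$$
   Context: Vertices and trees. Let $o$ be the root, $\mathcal{V}_0=\{o\}$, $\mathcal{V}_n=\{1,2,\ldots\}^n$ for $n\ge1$, and $\mathcal{V}=\bigcup_{n\ge0}\mathcal{V}_n$. For $v=(v_1,\ldots,v_n)\in\mathcal{V}_n$, $n\ge1$, the parent is $v^-=(v_1,\ldots,v_{n-1})$ (with $v^-=o$ if $n=1$); if $v_n\ge2$ put $v'=(v_1,\ldots,v_{n-1},v_n-1)$, otherwise $v'$ is undefined. For $v\in\mathcal V$ and $i\geq 1$, $(v,i)$ denotes $v$ with $i$ appended, with $(o,i)=(i)$. A set $V\subset\mathcal{V}$ induces the edges between $v$ and $v^-$ whenever $v,v^-\in V$; a tree $T$ is a connected graph with vertex set $V(T)\subset\mathcal{V}$ and the induced edges, so it is determined by $V(T)$. Write $|T|$ for the number of vertices. For trees $T,T'$, $T\subseteq T'$ (also written $T\subset T'$) means $V(T)\subseteq V(T')$. A random tree is regarded as a random element of $\{0,1\}^{\mathcal V}$ with the product $\sigma$-algebra. Uniform trees. $\mathcal{F}$ is the set of trees $T$ with $o\in V(T)$ such that $v\in V(T)$ implies $v'\in V(T)$ whenever $v'$ exists (rooted ordered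 trees). For $1\le k<\infty$, $\mathcal{T}_k$ is the uniform distribution on $\{T\in\mathcal{F}:|T|=k\}$. Geometric Galton-Watson tree. For $p\in(0,1)$ let $(X_v)_{v\in\mathcal{V}}$ be i.i.d. with $\mathbb{P}(X_v=k)=p^k(1-p)$, $k=0,1,\ldots$. Let $V_0(T(p))=\{o\}$, $V_{n+1}(T(p))=\bigcup_{v\in V_n(T(p))}\bigcup_{1\le i\le X_v}\{(v,i)\}$, and let $T(p)$ be the tree with vertex set $\bigcup_{n\ge0}V_n(T(p))$. For $p=1$, $X_v=\infty$ for all $v$, so $T(1)$ is the deterministic tree with vertex set $\mathcal{V}$. Infinite trees. For $p>1/2$, $\mathbb{P}(|T(p)|=\infty)>0$, and $\mathcal{T}_\infty(p)$ is the law of $T(p)$ conditioned on $|T(p)|=\infty$. For $p=1/2$, $\mathcal{T}_\infty(1/2)$ is the law of $T_\infty(1/2):=\bigcup_{k\ge1}T_k$, where $(T_k)_{k\ge1}$ is a coupling with $T_k\sim\mathcal{T}_k$ for every $k$ and $\mathbb{P}(T_1\subset T_2\subset\cdots)=1$; such a coupling exists by a theorem of Luczak and Winkler, and the law of the union does not depend on which such coupling is chosen. *)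

theory Defs
  imports "HOL-Probability.Probability"
begin

type_synonym vertex = "nat list"

text \<open>The root is \<^term>\<open>[]\<close>, the child \<open>(v, i)\<close> is \<open>v @ [i]\<close>, and children are numbered from 1.\<close>

definition vertices :: "vertex set" where
  "vertices = {v. \<forall>i\<in>set v. 1 \<le> i}"

definition parent :: "vertex \<Rightarrow> vertex" where
  "parent v = butlast v"

definition has_prev_sibling :: "vertex \<Rightarrow> bool" where
  "has_prev_sibling v \<longleftrightarrow> v \<noteq> [] \<and> 2 \<le> last v"

definition prev_sibling :: "vertex \<Rightarrow> vertex" where
  "prev_sibling v = butlast v @ [last v - 1]"

definition induced_edges :: "vertex set \<Rightarrow> (vertex \<times> vertex) set" where
  "induced_edges T = {(v, parent v) | v. v \<noteq> [] \<and> v \<in> T \<and> parent v \<in> T}"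

text \<open>A tree is identified with its vertex set.\<close>

definition is_tree :: "vertex set \<Rightarrow> bool" where
  "is_tree T \<longleftrightarrow> T \<subseteq> vertices \<and> T \<noteq> {} \<and>
     (\<forall>u\<in>T. \<forall>v\<in>T. (u, v) \<in> (induced_edges T \<union> (induced_edges T)\<inverse>)\<^sup>*)"

definition rooted_ordered_trees :: "vertex set set" where
  "rooted_ordered_trees =
     {T. is_tree T \<and> [] \<in> T \<and> (\<forall>v\<in>T. has_prev_sibling v \<longrightarrow> prev_sibling v \<in> T)}"

text \<open>The product \<open>\<sigma>\<close>-algebra on \<open>{0,1}\<close> to the power \<^term>\<open>vertices\<close>, transported to sets of
  vertices along indicator functions.\<close>

definition tree_space :: "vertex set measure" where
  "tree_space = vimage_algebra (Pow vertices) (\<lambda>T. \<lambda>v\<in>vertices. v \<in> T)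
     (\<Pi>\<^sub>M v\<in>vertices. count_space (UNIV :: bool set))"

definition uniform_tree_law :: "nat \<Rightarrow> vertex set measure" where
  "uniform_tree_law k =
     distr (uniform_count_measure {T \<in> rooted_ordered_trees. finite T \<and> card T = k})
       tree_space (\<lambda>T. T)"

text \<open>Note that \<^term>\<open>geometric_pmf q\<close> has mass \<open>(1 - q) ^ k * q\<close> at \<open>k\<close>. The value \<open>p = 1\<close>
  is the degenerate case of infinitely many children.\<close>

definition offspring_pmf :: "real \<Rightarrow> enat pmf" where
  "offspring_pmf p = (if p = 1 then return_pmf \<infinity> else map_pmf enat (geometric_pmf (1 - p)))"

primrec gw_generation :: "(vertex \<Rightarrow> enat) \<Rightarrow> nat \<Rightarrow> vertex set" where
  "gw_generation X 0 = {[]}"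
| "gw_generation X (Suc n) =
     (\<Union>v\<in>gw_generation X n. \<Union>i\<in>{i. 1 \<le> i \<and> enat i \<le> X v}. {v @ [i]})"

definition gw_tree :: "(vertex \<Rightarrow> enat) \<Rightarrow> vertex set" where
  "gw_tree X = (\<Union>n. gw_generation X n)"

definition gw_law :: "real \<Rightarrow> vertex set measure" where
  "gw_law p = distr (\<Pi>\<^sub>M v\<in>vertices. measure_pmf (offspring_pmf p)) tree_space gw_tree"

definition has_law :: "'a measure \<Rightarrow> ('a \<Rightarrow> vertex set) \<Rightarrow> vertex set measure \<Rightarrow> bool" where
  "has_law M T N \<longleftrightarrow> T \<in> M \<rightarrow>\<^sub>M tree_space \<and> distr M tree_space T = N"

definition increasing_uniform_coupling :: "'a measure \<Rightarrow> (nat \<Rightarrow> 'a \<Rightarrow> vertex set) \<Rightarrow> bool" where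
  "increasing_uniform_coupling M T \<longleftrightarrow> prob_space M \<and>
     (\<forall>k\<ge>1. has_law M (T k) (uniform_tree_law k)) \<and>
     measure M {\<omega> \<in> space M. \<forall>k\<ge>1. T k \<omega> \<subseteq> T (Suc k) \<omega>} = 1"

text \<open>The definite description is legitimate: such a coupling exists (Luczak and Winkler), and
  the law of the union is the same for all of them. Taking the sample space to consist of
  sequences of vertex sets loses no generality, since a coupling on any probability space can be
  replaced by the joint law of its trees.\<close>

definition critical_infinite_tree_law :: "vertex set measure" where
  "critical_infinite_tree_law =
     (THE N. \<exists>(M :: (nat \<Rightarrow> vertex set) measure) T.
        increasing_uniform_coupling M T \<and> has_law M (\<lambda>\<omega>. \<Union>k\<in>{1..}. T k \<omega>) N)"

text \<open>Meaningful for \<open>1/2 \<le> p \<le> 1\<close>; \<^const>\<open>uniform_measure\<close> conditions on an event.\<close>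

definition infinite_tree_law :: "real \<Rightarrow> vertex set measure" where
  "infinite_tree_law p =
     (if p = 1/2 then critical_infinite_tree_law
      else uniform_measure (gw_law p) {T \<in> space (gw_law p). infinite T})"

end

theory Submission
  imports Defs "HOL-Computational_Algebra.Formal_Power_Series"
begin

text \<open>
  An ordered tree with at least two vertices splits into the subtree at the first child of the root and
  the remainder, which keeps the root. This turns inclusion of trees into inclusion of both parts, and all
  the random trees in question are branching processes along this split. Give a tree the type \<open>n\<close> if it is
  uniform with \<open>n\<close> vertices, and the type \<open>\<infinity>\<close> if it has the law of \<open>T(p)\<close> conditioned to be infinite, where
  \<open>p > 1/2\<close> and \<open>q = 1 - p\<close>. With \<open>N\<^sub>n\<close> the number of ordered trees with \<open>n\<close> vertices,
    \<^item> a tree of type \<open>n \<ge> 2\<close> splits into independent trees of types \<open>i\<close> and \<open>n - i\<close> with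
      probability \<open>N\<^sub>i N\<^sub>n\<^sub>-\<^sub>i / N\<^sub>n\<close>;
    \<^item> a tree of type \<open>\<infinity>\<close> splits into types \<open>(m, \<infinity>)\<close> with probability \<open>N\<^sub>m (p q)\<^sup>m\<close>, into \<open>(\<infinity>, m)\<close> with the
      same probability, and into \<open>(\<infinity>, \<infinity>)\<close> with the remaining probability \<open>p - q\<close>.

  The distribution function of the type of the first part decreases when the type grows, and for type
  \<open>\<infinity>\<close> also when \<open>q\<close> decreases (\<open>split_cdf_antimono\<close>). For finite types this is the log-convexity of the
  Catalan numbers \<open>N\<^sub>n\<close>; a finite type compares with \<open>\<infinity>\<close> because \<open>N\<^sub>n\<^sub>+\<^sub>1 \<le> 4 N\<^sub>n\<close> and \<open>p q \<le> 1/4\<close>; and two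
  infinite types compare because \<open>q (1 - q)\<close> increases on the interval from 0 to 1/2. The split is symmetric, so the
  second part has the same property. Now put an independent uniform variable at each node of the binary
  tree of splits and let it determine the types of both parts through quantile functions. Then all types
  are monotone simultaneously and all the grown trees are nested, for every outcome (\<open>grown_tree_mono\<close>).

  It remains to identify the laws, through the probabilities of containing a given finite tree
  \<open>A\<close>. On the split tree they satisfy a recursion (\<open>cover_prob_Join\<close>), which is solved for type \<open>n\<close> by the
  proportion of trees of size \<open>n\<close> that contain \<open>A\<close>, and for type \<open>\<infinity>\<close> by
  \<open>(p ^ |A| - H(A)) / (p - q)\<close>, where \<open>H(A)\<close> is the sum of \<open>(p q) ^ |T|\<close> over the finite trees \<open>T\<close> containing \<open>A\<close>.
  Direct computation gives the same value for the Galton-Watson tree conditioned to be infinite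
  (\<open>infinite_tree_law_eq_grown\<close>).

  At \<open>p = 1/2\<close> the grown trees of types \<open>1, 2, \<dots>\<close> are themselves an increasing coupling of the uniform
  trees, which gives the existence part of the theorem of Luczak and Winkler, and the law of the union is
  the same for all such couplings. So the critical tree may be taken to be the union of the grown trees of finite
  types (\<open>critical_infinite_tree_law_eq_grown\<close>), and this union lies in every grown tree of type \<open>\<infinity>\<close>.
\<close>

section \<open>Ordered trees and their binary codes\<close>

text \<open>Cutting the edge from the root to its first child splits an ordered tree with at least two
  vertices into the subtree at that child and the remainder, which keeps the root; each part is again
  an ordered tree. Iterating gives the binary codes below: \<open>Join l r\<close> has first subtree \<open>l\<close> and
  remainder \<open>r\<close>, and each leaf of the code is one vertex of the tree.\<close>
datatype code = Stump | Join code code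

primrec leaves :: "code \<Rightarrow> nat" where
  "leaves Stump = 1"
| "leaves (Join l r) = leaves l + leaves r"

primrec embeds :: "code \<Rightarrow> code \<Rightarrow> bool" where
  "embeds Stump t = True"
| "embeds (Join l r) t = (case t of Stump \<Rightarrow> False | Join l' r' \<Rightarrow> embeds l l' \<and> embeds r r')"

text \<open>Position in the whole tree of a vertex of the remainder: the children of the root move up by
  one because the first child was cut off.\<close>
fun shift_first :: "vertex \<Rightarrow> vertex" where
  "shift_first [] = []"
| "shift_first (i # w) = Suc i # w"

primrec plane :: "code \<Rightarrow> vertex set" where
  "plane Stump = {[]}"
| "plane (Join l r) = Cons (Suc 0) ` plane l \<union> shift_first ` plane r"

definition first_subtree :: "vertex set \<Rightarrow> vertex set" where
  "first_subtree T = {w. Suc 0 # w \<in> T}"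

definition remainder :: "vertex set \<Rightarrow> vertex set" where
  "remainder T = {w \<in> vertices. shift_first w \<in> T}"

text \<open>The rooted ordered trees, finite or infinite; \<open>rooted_ordered_trees_eq\<close> shows that connectedness
  amounts to closure under parents.\<close>
definition plane_closed :: "vertex set \<Rightarrow> bool" where
  "plane_closed T \<longleftrightarrow> T \<subseteq> vertices \<and> [] \<in> T \<and>
     (\<forall>v\<in>T. v \<noteq> [] \<longrightarrow> butlast v \<in> T) \<and> (\<forall>v\<in>T. has_prev_sibling v \<longrightarrow> prev_sibling v \<in> T)"

lemma inj_shift_first: "inj shift_first"
proof (rule injI)
  fix x y assume "shift_first x = shift_first y" thus "x = y" by (cases x; cases y) auto
qed

lemma Nil_in_plane [simp]: "[] \<in> plane t"
  by (induction t) (auto intro: image_eqI[where x="[]"])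

lemma plane_subset_vertices: "plane t \<subseteq> vertices"
proof (induction t)
  case (Join l r)
  have "shift_first v \<in> vertices" if "v \<in> vertices" for v
    using that by (cases v) (auto simp: vertices_def)
  moreover have "Suc 0 # v \<in> vertices" if "v \<in> vertices" for v
    using that by (auto simp: vertices_def)
  ultimately show ?case using Join by auto
qed (auto simp: vertices_def)

lemma finite_plane [simp]: "finite (plane t)"
  by (induction t) auto

lemma first_not_shift: "w \<in> vertices \<Longrightarrow> Suc 0 # v \<noteq> shift_first w"
  by (cases w) (auto simp: vertices_def)

lemma card_plane: "card (plane t) = leaves t"
proof (induction t)
  case (Join l r)
  have "Cons (Suc 0) ` plane l \<inter> shift_first ` plane r = {}"
    using plane_subset_vertices[of r] first_not_shift by blast
  thus ?case
    using Join by (simp add: card_Un_disjoint card_image inj_shift_first inj_on_subset[OF inj_shift_first])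
qed auto

text \<open>Containing a given finite tree decomposes along the split. All probabilities of events
  \<open>plane t \<subseteq> T\<close> are computed from this recursion.\<close>
lemma plane_Join_subset_iff:
  "plane (Join l r) \<subseteq> T \<longleftrightarrow> plane l \<subseteq> first_subtree T \<and> plane r \<subseteq> remainder T"
  using plane_subset_vertices[of r] by (auto simp: first_subtree_def remainder_def)

lemma first_subtree_plane_Join: "first_subtree (plane (Join l r)) = plane l"
  using plane_subset_vertices[of r] first_not_shift by (auto simp: first_subtree_def)

lemma remainder_plane_Join: "remainder (plane (Join l r)) = plane r"
  using plane_subset_vertices[of r] first_not_shift[symmetric]
  by (fastforce simp: remainder_def dest: injD[OF inj_shift_first])

lemma leaves_pos [simp]: "0 < leaves t"
  by (induction t) auto

text \<open>Inclusion of trees becomes a structural order on codes; antisymmetry of that order then gives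
  the injectivity of the coding.\<close>
lemma plane_subset_iff_embeds: "plane t \<subseteq> plane t' \<longleftrightarrow> embeds t t'"
proof (induction t arbitrary: t')
  case (Join l r)
  show ?case
  proof (cases t')
    case Stump
    have "Suc 0 # [] \<in> plane (Join l r)" by auto
    hence "\<not> plane (Join l r) \<subseteq> {[]}" by blast
    thus ?thesis using Stump by simp
  next
    case (Join l' r')
    show ?thesis
      unfolding plane_Join_subset_iff Join first_subtree_plane_Join remainder_plane_Join
      by (simp add: Join.IH)
  qed
qed auto

lemma embeds_antisym: "embeds t t' \<Longrightarrow> embeds t' t \<Longrightarrow> t = t'"
proof (induction t arbitrary: t')
  case Stump thus ?case by (cases t') auto
next
  case (Join l r) thus ?case by (cases t') auto
qed

lemma inj_plane: "inj plane"
  by (rule injI) (auto intro!: embeds_antisym simp flip: plane_subset_iff_embeds)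

primrec merge_code :: "code \<Rightarrow> code \<Rightarrow> code" where
  "merge_code Stump t = t"
| "merge_code (Join l r) t =
     (case t of Stump \<Rightarrow> Join l r | Join l' r' \<Rightarrow> Join (merge_code l l') (merge_code r r'))"

lemma plane_merge_code: "plane (merge_code t t') = plane t \<union> plane t'"
proof (induction t arbitrary: t')
  case (Join l r)
  show ?case
  proof (cases t')
    case Stump thus ?thesis using Nil_in_plane[of "Join l r"] by (auto simp del: Nil_in_plane)
  next
    case (Join l' r') thus ?thesis by (auto simp: Join.IH)
  qed
qed auto

text \<open>Code of the least rooted ordered tree that contains the given vertex.\<close>
fun path_code :: "vertex \<Rightarrow> code" where
  "path_code [] = Stump"
| "path_code (0 # w) = Stump"
| "path_code (Suc 0 # w) = Join (path_code w) Stump"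
| "path_code (Suc (Suc i) # w) = Join Stump (path_code (Suc i # w))"

lemma in_plane_path_code: "v \<in> vertices \<Longrightarrow> v \<in> plane (path_code v)"
proof (induction v rule: path_code.induct)
  case (4 i w)
  hence "Suc i # w \<in> plane (path_code (Suc i # w))" by (simp add: vertices_def)
  hence "shift_first (Suc i # w) \<in> shift_first ` plane (path_code (Suc i # w))" by (rule imageI)
  thus ?case by simp
qed (auto simp: vertices_def)

lemma plane_closed_take:
  assumes "plane_closed T" "v @ w \<in> T" shows "v \<in> T"
  using assms(2)
proof (induction w rule: rev_induct)
  case (snoc i w)
  hence "butlast (v @ w @ [i]) \<in> T" using assms(1) by (auto simp: plane_closed_def simp del: butlast_append)
  thus ?case using snoc.IH by (simp add: butlast_append)
qed auto

lemma plane_closed_earlier_child: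
  assumes "plane_closed T" "v @ [Suc (i + n)] \<in> T" shows "v @ [Suc i] \<in> T"
  using assms(2)
proof (induction n)
  case (Suc n)
  have "has_prev_sibling (v @ [Suc (i + Suc n)])" by (simp add: has_prev_sibling_def)
  hence "prev_sibling (v @ [Suc (i + Suc n)]) \<in> T"
    using Suc.prems assms(1) unfolding plane_closed_def by blast
  thus ?case using Suc.IH by (simp add: prev_sibling_def)
qed auto

lemma plane_closed_first_subtree:
  assumes T: "plane_closed T" and w: "Suc 0 # w \<in> T" shows "plane_closed (first_subtree T)"
proof -
  have "Suc 0 # [] \<in> T" using plane_closed_take[OF T, of "[Suc 0]" w] w by simp
  moreover have "butlast v \<in> first_subtree T" if "v \<in> first_subtree T" "v \<noteq> []" for v
  proof -
    have "butlast (Suc 0 # v) \<in> T" using that T unfolding plane_closed_def first_subtree_def by blast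
    thus ?thesis using that by (simp add: first_subtree_def)
  qed
  moreover have "prev_sibling v \<in> first_subtree T" if "v \<in> first_subtree T" "has_prev_sibling v" for v
  proof -
    have "has_prev_sibling (Suc 0 # v)" using that by (auto simp: has_prev_sibling_def)
    hence "prev_sibling (Suc 0 # v) \<in> T" using that T unfolding plane_closed_def first_subtree_def by blast
    thus ?thesis using that by (auto simp: first_subtree_def prev_sibling_def has_prev_sibling_def)
  qed
  moreover have "first_subtree T \<subseteq> vertices" using T by (auto simp: plane_closed_def first_subtree_def vertices_def)
  ultimately show ?thesis by (auto simp: plane_closed_def first_subtree_def)
qed

lemma plane_closed_remainder:
  assumes T: "plane_closed T" shows "plane_closed (remainder T)"
proof -
  have "butlast v \<in> remainder T" if v: "v \<in> remainder T" "v \<noteq> []" for v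
  proof -
    obtain i w where vw: "v = i # w" using v by (cases v) auto
    have "butlast (shift_first v) \<in> T" using v T unfolding plane_closed_def remainder_def by (auto simp: vw)
    moreover have "butlast v \<in> vertices" using v by (auto simp: remainder_def vertices_def dest: in_set_butlastD)
    moreover have "[] \<in> T" using T by (simp add: plane_closed_def)
    ultimately show ?thesis by (cases w) (auto simp: remainder_def vw)
  qed
  moreover have "prev_sibling v \<in> remainder T" if v: "v \<in> remainder T" "has_prev_sibling v" for v
  proof -
    obtain i w where vw: "v = i # w" using v by (cases v) (auto simp: has_prev_sibling_def)
    have "has_prev_sibling (shift_first v)" using v by (auto simp: has_prev_sibling_def vw)
    hence "prev_sibling (shift_first v) \<in> T" using v T unfolding plane_closed_def remainder_def by blast
    moreover have "prev_sibling (shift_first v) = shift_first (prev_sibling v)"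
      using v by (cases w) (auto simp: prev_sibling_def vw has_prev_sibling_def)
    moreover have "prev_sibling v \<in> vertices" using v
      by (auto simp: remainder_def vertices_def prev_sibling_def has_prev_sibling_def dest: in_set_butlastD)
    ultimately show ?thesis by (simp add: remainder_def)
  qed
  moreover have "[] \<in> remainder T" using T by (auto simp: plane_closed_def remainder_def vertices_def)
  ultimately show ?thesis by (auto simp: plane_closed_def remainder_def)
qed

lemma plane_path_code_subset_iff:
  assumes "plane_closed T" "v \<in> vertices"
  shows "plane (path_code v) \<subseteq> T \<longleftrightarrow> v \<in> T"
proof
  assume "plane (path_code v) \<subseteq> T" thus "v \<in> T" using in_plane_path_code assms by blast
next
  assume "v \<in> T"
  thus "plane (path_code v) \<subseteq> T" using assms
  proof (induction v arbitrary: T rule: path_code.induct)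
    case (3 w)
    have c: "plane_closed (first_subtree T)" using 3 by (intro plane_closed_first_subtree)
    have "plane (path_code w) \<subseteq> first_subtree T" using 3 c by (auto simp: first_subtree_def vertices_def)
    moreover have "plane Stump \<subseteq> remainder T"
      using plane_closed_remainder[OF 3(3)] by (auto simp: plane_closed_def)
    ultimately show ?case by (simp only: path_code.simps plane_Join_subset_iff simp_thms)
  next
    case (4 i w)
    have c: "plane_closed (remainder T)" using 4 by (intro plane_closed_remainder)
    have "Suc i # w \<in> remainder T" using 4 by (auto simp: remainder_def vertices_def)
    hence "plane (path_code (Suc i # w)) \<subseteq> remainder T" using 4 c by (auto simp: vertices_def)
    moreover have "[] @ [Suc (Suc i)] \<in> T" using plane_closed_take[OF 4(3), of "[Suc (Suc i)]" w] 4(2) by simp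
    hence "Suc 0 # [] \<in> T" using plane_closed_earlier_child[OF 4(3), of "[]" 0 "Suc i"] by simp
    hence "plane Stump \<subseteq> first_subtree T" by (simp add: first_subtree_def)
    ultimately show ?case by (simp only: path_code.simps plane_Join_subset_iff simp_thms)
  qed (auto simp: plane_closed_def vertices_def)
qed

text \<open>A finite set of vertices has a finite closure under parents and previous siblings, so that the
  events \<open>A \<subseteq> T\<close> with \<open>A\<close> finite reduce to \<open>plane t \<subseteq> T\<close>.\<close>
lemma code_of_finite_set:
  assumes "finite A" "A \<subseteq> vertices"
  shows "\<exists>t. A \<subseteq> plane t \<and> (\<forall>T. plane_closed T \<longrightarrow> (plane t \<subseteq> T \<longleftrightarrow> A \<subseteq> T))"
  using assms
proof (induction A rule: finite_induct)
  case empty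
  thus ?case by (intro exI[of _ Stump]) (auto simp: plane_closed_def)
next
  case (insert v A)
  then obtain t where t: "A \<subseteq> plane t" "\<forall>T. plane_closed T \<longrightarrow> (plane t \<subseteq> T \<longleftrightarrow> A \<subseteq> T)" by auto
  have v: "v \<in> vertices" using insert.prems by simp
  show ?case
    using t in_plane_path_code[OF v] plane_path_code_subset_iff[OF _ v]
    by (intro exI[of _ "merge_code (path_code v) t"]) (auto simp: plane_merge_code)
qed

lemma plane_closed_plane: "plane_closed (plane t)"
proof -
  have b: "butlast v \<in> plane t" if "v \<in> plane t" for v t
    using that
  proof (induction t arbitrary: v)
    case (Join l r)
    from Join.prems consider w where "v = Suc 0 # w" "w \<in> plane l" | w where "v = shift_first w" "w \<in> plane r"
      by auto
    thus ?case
    proof cases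
      case 1
      thus ?thesis using Join.IH(1)[of w] Nil_in_plane[of "Join l r"] by (auto simp del: Nil_in_plane)
    next
      case 2
      show ?thesis
      proof (cases w)
        case Nil thus ?thesis using 2 Nil_in_plane[of "Join l r"] by simp
      next
        case (Cons i w')
        hence "shift_first (butlast w) \<in> shift_first ` plane r" using Join.IH(2)[of w] 2 by (intro imageI)
        thus ?thesis using 2 Cons Nil_in_plane[of "Join l r"]  by (cases w') (auto simp del: Nil_in_plane)
      qed
    qed
  qed auto
  have s: "prev_sibling v \<in> plane t" if "v \<in> plane t" "has_prev_sibling v" for v t
    using that
  proof (induction t arbitrary: v)
    case (Join l r)
    from Join.prems consider w where "v = Suc 0 # w" "w \<in> plane l" | w where "v = shift_first w" "w \<in> plane r"
      by auto
    thus ?case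
    proof cases
      case 1
      hence "has_prev_sibling w" "prev_sibling v = Suc 0 # prev_sibling w"
        using Join.prems(2) by (auto simp: has_prev_sibling_def prev_sibling_def split: if_splits)
      thus ?thesis using 1 Join.IH(1)[of w] by simp
    next
      case 2
      obtain i w' where w: "w = i # w'" using 2 Join.prems(2) by (cases w) (auto simp: has_prev_sibling_def)
      have i: "1 \<le> i" using 2 w plane_subset_vertices[of r] by (auto simp: vertices_def)
      show ?thesis
      proof (cases "has_prev_sibling w")
        case True
        hence "prev_sibling v = shift_first (prev_sibling w)" using 2 w
          by (cases w') (auto simp: prev_sibling_def has_prev_sibling_def)
        thus ?thesis using True 2 Join.IH(2)[of w] by simp
      next
        case False
        hence "w = [Suc 0]" using Join.prems(2) i w 2
          by (cases w') (auto simp: has_prev_sibling_def)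
        thus ?thesis using 2 by (simp add: prev_sibling_def)
      qed
    qed
  qed (auto simp: has_prev_sibling_def)
  show ?thesis unfolding plane_closed_def using b s plane_subset_vertices by auto
qed

text \<open>Connected and containing the root means closed under parents: if \<open>v\<close> is in \<open>T\<close> but its parent
  is not, no induced edge leaves the set of vertices of \<open>T\<close> with prefix \<open>v\<close>, so \<open>v\<close> cannot reach the
  root.\<close>
lemma rooted_ordered_trees_eq: "rooted_ordered_trees = {T. plane_closed T}"
proof (intro set_eqI iffI; unfold mem_Collect_eq)
  fix T assume T: "plane_closed T"
  let ?E = "induced_edges T \<union> (induced_edges T)\<inverse>"
  have "(v, []) \<in> ?E\<^sup>*" if "v \<in> T" for v
    using that
  proof (induction v rule: rev_induct)
    case (snoc i v)
    have v: "v \<in> T" using plane_closed_take[OF T snoc.prems] .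
    hence "(v @ [i], v) \<in> ?E" using snoc.prems by (auto simp: induced_edges_def parent_def)
    thus ?case using snoc.IH[OF v] by (rule converse_rtrancl_into_rtrancl)
  qed auto
  moreover have "sym ?E" by (auto simp: sym_def)
  ultimately have "(u, v) \<in> ?E\<^sup>*" if "u \<in> T" "v \<in> T" for u v
    using that by (meson rtrancl_trans sym_rtrancl symD)
  thus "T \<in> rooted_ordered_trees"
    using T by (auto simp: rooted_ordered_trees_def is_tree_def plane_closed_def)
next
  fix T assume T: "T \<in> rooted_ordered_trees"
  let ?E = "induced_edges T \<union> (induced_edges T)\<inverse>"
  have "butlast v \<in> T" if v: "v \<in> T" "v \<noteq> []" for v
  proof (rule ccontr)
    assume nb: "butlast v \<notin> T"
    \<comment> \<open>An edge of \<open>T\<close> cannot leave the set of vertices with prefix \<open>v\<close>.\<close>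
    have step: "\<exists>x. z = v @ x" if yz: "(y, z) \<in> ?E" and y: "\<exists>x. y = v @ x" for y z
    proof -
      obtain x where x: "y = v @ x" using y by blast
      from yz show ?thesis
      proof
        assume "(y, z) \<in> induced_edges T"
        hence "z = butlast y" "z \<in> T" by (auto simp: induced_edges_def parent_def)
        thus ?thesis using x nb by (cases x rule: rev_cases) (auto simp: butlast_append)
      next
        assume "(y, z) \<in> (induced_edges T)\<inverse>"
        hence "y = butlast z" "z \<noteq> []" by (auto simp: induced_edges_def parent_def)
        hence "z = v @ x @ [last z]" using x by (metis append_butlast_last_id append.assoc)
        thus ?thesis by blast
      qed
    qed
    have "(v, []) \<in> ?E\<^sup>*" using T v by (auto simp: rooted_ordered_trees_def is_tree_def)
    hence "\<exists>x. [] = v @ x" by (induction rule: rtrancl_induct) (use step in \<open>blast+\<close>)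
    thus False using v by simp
  qed
  thus "plane_closed T"
    using T by (auto simp: rooted_ordered_trees_def is_tree_def plane_closed_def)
qed

lemma finite_rooted_ordered_trees_eq:
  "{T \<in> rooted_ordered_trees. finite T \<and> card T = k} = plane ` {t. leaves t = k}"
proof (intro equalityI subsetI)
  fix T assume "T \<in> {T \<in> rooted_ordered_trees. finite T \<and> card T = k}"
  hence T: "plane_closed T" "finite T" "card T = k" by (auto simp: rooted_ordered_trees_eq)
  have "T \<subseteq> vertices" using T(1) by (simp add: plane_closed_def)
  then obtain t where t: "T \<subseteq> plane t" "\<forall>S. plane_closed S \<longrightarrow> (plane t \<subseteq> S \<longleftrightarrow> T \<subseteq> S)"
    using code_of_finite_set[OF T(2)] by blast
  have "T = plane t" using t T by blast
  thus "T \<in> plane ` {t. leaves t = k}" using T card_plane by auto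
qed (auto simp: rooted_ordered_trees_eq plane_closed_plane card_plane)

section \<open>Counting ordered trees\<close>

text \<open>The number of trees with \<open>n\<close> vertices that contain the tree coded by \<open>t\<close>. For the one-vertex tree
  this is the Catalan number with index \<open>n - 1\<close>.\<close>
definition extensions :: "code \<Rightarrow> nat \<Rightarrow> nat" where
  "extensions t n = card {t'. leaves t' = n \<and> embeds t t'}"

abbreviation tree_count :: "nat \<Rightarrow> nat" where
  "tree_count \<equiv> extensions Stump"

lemma finite_leaves_eq: "finite {t. leaves t = n}"
proof (induction n rule: less_induct)
  case (less n)
  have "{t. leaves t = n} \<subseteq> {Stump} \<union>
      (\<Union>i\<in>{..<n}. \<Union>j\<in>{..<n}. case_prod Join ` ({t. leaves t = i} \<times> {t. leaves t = j}))"
  proof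
    fix t assume t: "t \<in> {t. leaves t = n}"
    show "t \<in> {Stump} \<union>
      (\<Union>i\<in>{..<n}. \<Union>j\<in>{..<n}. case_prod Join ` ({t. leaves t = i} \<times> {t. leaves t = j}))"
    proof (cases t)
      case (Join l r)
      hence "leaves l < n" "leaves r < n" using t by auto
      thus ?thesis unfolding Join
        by (intro UnI2 UN_I[of "leaves l"] UN_I[of "leaves r"] image_eqI[of _ _ "(l, r)"]) auto
    qed auto
  qed
  thus ?case by (rule finite_subset) (auto intro!: less)
qed

lemma finite_extensions: "finite {t'. leaves t' = n \<and> embeds t t'}"
  by (rule finite_subset[OF _ finite_leaves_eq[of n]]) auto

lemma extensions_le_tree_count: "extensions t n \<le> tree_count n"
  unfolding extensions_def by (intro card_mono finite_extensions) auto

lemma extensions_0 [simp]: "extensions t 0 = 0"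
proof -
  have "{t'. leaves t' = 0 \<and> embeds t t'} = {}" by (simp add: leaves_pos[THEN less_imp_neq, symmetric] del: leaves_pos)
  thus ?thesis by (simp only: extensions_def card.empty)
qed

lemma extensions_Join:
  "extensions (Join l r) n = (\<Sum>i\<le>n. extensions l i * extensions r (n - i))"
proof -
  let ?S = "\<lambda>i. case_prod Join ` ({t. leaves t = i \<and> embeds l t} \<times> {t. leaves t = n - i \<and> embeds r t})"
  have "{t'. leaves t' = n \<and> embeds (Join l r) t'} = (\<Union>i\<in>{..n}. ?S i)"
  proof (intro equalityI subsetI)
    fix t assume "t \<in> {t'. leaves t' = n \<and> embeds (Join l r) t'}"
    thus "t \<in> (\<Union>i\<in>{..n}. ?S i)" by (cases t) (auto intro!: image_eqI[where x="(_, _)"])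
  qed auto
  hence "extensions (Join l r) n = card (\<Union>i\<in>{..n}. ?S i)" by (simp add: extensions_def)
  also have "\<dots> = (\<Sum>i\<le>n. card (?S i))"
    by (intro card_UN_disjoint) (auto intro!: finite_imageI finite_cartesian_product finite_extensions)
  also have "\<dots> = (\<Sum>i\<le>n. extensions l i * extensions r (n - i))"
  proof (rule sum.cong[OF refl])
    fix i show "card (?S i) = extensions l i * extensions r (n - i)"
      by (subst card_image) (auto simp: inj_on_def extensions_def card_cartesian_product)
  qed
  finally show ?thesis .
qed

lemma tree_count_rec:
  "tree_count n = (if n = 1 then 1 else 0) + (\<Sum>i\<le>n. tree_count i * tree_count (n - i))"
proof -
  have "{t. leaves t = n} = (if n = 1 then {Stump} else {}) \<union> {t. leaves t = n \<and> embeds (Join Stump Stump) t}"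
    (is "_ = ?A \<union> ?B")
  proof (intro equalityI subsetI)
    fix t assume "t \<in> {t. leaves t = n}"
    thus "t \<in> ?A \<union> ?B" by (cases t) auto
  qed (auto split: if_splits)
  moreover have "card (?A \<union> ?B) = card ?A + card ?B"
    by (intro card_Un_disjoint finite_extensions) (auto split: if_splits)
  ultimately have "tree_count n = card ?A + extensions (Join Stump Stump) n"
    by (simp add: extensions_def)
  thus ?thesis by (simp add: extensions_Join)
qed

text \<open>The generating function satisfies \<open>G = X + G\<^sup>2\<close>. Differentiating, \<open>G' (1 - 2 G) = 1\<close>, and since
  \<open>(1 - 2 G)\<^sup>2 = 1 - 4 X\<close>, also \<open>G' (1 - 4 X) = 1 - 2 G\<close>; the claim is the coefficient of \<open>X\<^sup>n\<close>.\<close>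
lemma tree_count_ratio:
  assumes "1 \<le> n"
  shows "real (n + 1) * real (tree_count (Suc n)) = (4 * real n - 2) * real (tree_count n)"
proof -
  define G :: "real fps" where "G = Abs_fps (\<lambda>n. real (tree_count n))"
  have G: "G = fps_X + G * G"
  proof (rule fps_ext)
    fix n show "fps_nth G n = fps_nth (fps_X + G * G) n"
      unfolding G_def by (subst tree_count_rec) (simp add: fps_mult_nth atLeast0AtMost)
  qed
  have "fps_deriv G = fps_deriv (fps_X + G * G)" by (rule arg_cong[OF G])
  hence D: "fps_deriv G = 1 + 2 * G * fps_deriv G" by (simp add: algebra_simps)
  have "G - G * G = (fps_X + G * G) - G * G" by (rule arg_cong[OF G])
  hence X: "fps_X = G - G * G" by (simp only: add_diff_cancel_right')
  have "fps_deriv G * (1 - 4 * fps_X) = fps_deriv G * (1 - 4 * (G - G * G))"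
    by (simp only: X)
  also have "\<dots> = (fps_deriv G - 2 * G * fps_deriv G) * (1 - 2 * G)" by (simp add: algebra_simps)
  also have "fps_deriv G - 2 * G * fps_deriv G = (1 + 2 * G * fps_deriv G) - 2 * G * fps_deriv G"
    by (rule arg_cong[OF D])
  finally have "fps_deriv G * (1 - 4 * fps_X) = 1 - 2 * G" by simp
  hence "fps_deriv G - fps_const 4 * (fps_X * fps_deriv G) = 1 - fps_const 2 * G"
    by (simp add: algebra_simps flip: numeral_fps_const)
  hence "fps_nth (fps_deriv G - fps_const 4 * (fps_X * fps_deriv G)) n = fps_nth (1 - fps_const 2 * G) n"
    by simp
  thus ?thesis using assms
    by (simp add: G_def) (simp add: algebra_simps)
qed

lemma tree_count_1 [simp]: "tree_count (Suc 0) = 1"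
  by (subst tree_count_rec) simp

lemma tree_count_pos: "1 \<le> n \<Longrightarrow> 0 < tree_count n"
proof (induction n rule: nat_induct_at_least)
  case (Suc n)
  have "0 < (4 * real n - 2) * real (tree_count n)" using Suc by (intro mult_pos_pos) auto
  hence "0 < real (n + 1) * real (tree_count (Suc n))" using tree_count_ratio[of n] Suc by simp
  thus ?case by (simp add: zero_less_mult_iff)
qed auto

text \<open>The ratio of consecutive counts is \<open>(4 n - 2) / (n + 1) = 4 - 6 / (n + 1)\<close>, which increases with
  \<open>n\<close>. This is what makes larger uniform trees split into larger parts.\<close>
lemma tree_count_log_convex:
  assumes "1 \<le> k" "k \<le> n"
  shows "real (tree_count (Suc k)) * tree_count n \<le> real (tree_count k) * tree_count (Suc n)"
proof -
  have r: "real (tree_count (Suc j)) = (4 * real j - 2) / (real j + 1) * tree_count j" if "1 \<le> j" for j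
    using tree_count_ratio[OF that] by (simp add: field_simps)
  have "(4 * real k - 2) / (real k + 1) \<le> (4 * real n - 2) / (real n + 1)"
    using assms by (simp add: field_simps)
  hence "(4 * real k - 2) / (real k + 1) * (real (tree_count k) * tree_count n)
    \<le> (4 * real n - 2) / (real n + 1) * (real (tree_count k) * tree_count n)"
    by (intro mult_right_mono) auto
  thus ?thesis using r[of k] r[of n] assms by (simp add: mult_ac)
qed

lemma tree_count_Suc_le: "1 \<le> n \<Longrightarrow> real (tree_count (Suc n)) \<le> 4 * real (tree_count n)"
proof -
  assume "1 \<le> n"
  have "real (n + 1) * real (tree_count (Suc n)) \<le> real (n + 1) * (4 * real (tree_count n))"
    unfolding tree_count_ratio[OF \<open>1 \<le> n\<close>] by (simp add: algebra_simps)
  thus ?thesis by (subst (asm) mult_le_cancel_left_pos) auto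
qed

lemma tree_count_add_le: "1 \<le> n \<Longrightarrow> real (tree_count (n + i)) \<le> 4 ^ i * real (tree_count n)"
proof (induction i)
  case (Suc i)
  have "real (tree_count (Suc (n + i))) \<le> 4 * real (tree_count (n + i))"
    using Suc by (intro tree_count_Suc_le) auto
  thus ?case using Suc by simp
qed auto

text \<open>This is \<open>q\<close> times the probability that the geometric Galton-Watson tree with parameter \<open>q\<close> has
  exactly \<open>i\<close> vertices.\<close>
definition weight :: "real \<Rightarrow> nat \<Rightarrow> real" where
  "weight q i = real (tree_count i) * (q * (1 - q)) ^ i"

lemma weight_0 [simp]: "weight q 0 = 0"
  by (simp add: weight_def)

lemma weight_nonneg: "0 \<le> q \<Longrightarrow> q \<le> 1 \<Longrightarrow> 0 \<le> weight q i"
  by (simp add: weight_def)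

lemma weight_rec:
  "weight q n = (if n = 1 then q * (1 - q) else 0) + (\<Sum>i\<le>n. weight q i * weight q (n - i))"
proof -
  let ?x = "q * (1 - q)"
  have "(\<Sum>i\<le>n. weight q i * weight q (n - i)) = (\<Sum>i\<le>n. real (tree_count i * tree_count (n - i)) * ?x ^ n)"
  proof (rule sum.cong[OF refl])
    fix i assume "i \<in> {..n}"
    hence "?x ^ n = ?x ^ i * ?x ^ (n - i)" by (simp flip: power_add)
    thus "weight q i * weight q (n - i) = real (tree_count i * tree_count (n - i)) * ?x ^ n"
      by (simp add: weight_def)
  qed
  also have "\<dots> = real (\<Sum>i\<le>n. tree_count i * tree_count (n - i)) * ?x ^ n"
    by (simp only: of_nat_sum sum_distrib_right)
  moreover have "weight q n = (if n = 1 then ?x else 0) + real (\<Sum>i\<le>n. tree_count i * tree_count (n - i)) * ?x ^ n"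
    unfolding weight_def[of q n] by (subst tree_count_rec) (simp add: distrib_right)
  ultimately show ?thesis by simp
qed

text \<open>Induction on \<open>m\<close>: a convolution term of index at most \<open>m + 1\<close> has both indices at most \<open>m\<close>, because
  the weight of index 0 vanishes, so the partial sums satisfy \<open>S\<^sub>m\<^sub>+\<^sub>1 \<le> q (1 - q) + S\<^sub>m\<^sup>2\<close>, and \<open>q\<close> is a fixed
  point of the right-hand side.\<close>
lemma sum_weight_le:
  assumes "0 \<le> q" "q \<le> 1/2"
  shows "(\<Sum>i\<le>m. weight q i) \<le> q"
proof (induction m)
  case 0 thus ?case using assms by simp
next
  case (Suc m)
  let ?a = "weight q"
  have nn: "0 \<le> ?a i" for i using assms by (intro weight_nonneg) auto
  have "(\<Sum>i\<le>Suc m. ?a i)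
      = (\<Sum>i\<le>Suc m. if i = 1 then q * (1 - q) else 0) + (\<Sum>k\<le>Suc m. \<Sum>i\<le>k. ?a i * ?a (k - i))"
    unfolding sum.distrib[symmetric] by (intro sum.cong refl weight_rec)
  also have "(\<Sum>i\<le>Suc m. if i = 1 then q * (1 - q) else 0) = q * (1 - q)"
    by (subst sum.delta) auto
  also have "(\<Sum>k\<le>Suc m. \<Sum>i\<le>k. ?a i * ?a (k - i)) = (\<Sum>(i, j)\<in>{(i, j). i + j \<le> Suc m}. ?a i * ?a j)"
    by (rule sum.triangle_reindex_eq[symmetric])
  also have "\<dots> = (\<Sum>(i, j)\<in>{(i, j). i + j \<le> Suc m} \<inter> {..m} \<times> {..m}. ?a i * ?a j)"
  proof (rule sum.mono_neutral_right)
    show "finite {(i, j). i + j \<le> Suc m}"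
      by (rule finite_subset[of _ "{..Suc m} \<times> {..Suc m}"]) auto
    show "\<forall>x\<in>{(i, j). i + j \<le> Suc m} - {(i, j). i + j \<le> Suc m} \<inter> {..m} \<times> {..m}.
        (case x of (i, j) \<Rightarrow> ?a i * ?a j) = 0"
    proof
      fix x assume x: "x \<in> {(i, j). i + j \<le> Suc m} - {(i, j). i + j \<le> Suc m} \<inter> {..m} \<times> {..m}"
      obtain i j where ij: "x = (i, j)" by (cases x)
      have "i + j \<le> Suc m" "\<not> (i \<le> m \<and> j \<le> m)" using x ij by auto
      hence "i = 0 \<or> j = 0" by presburger
      thus "(case x of (i, j) \<Rightarrow> ?a i * ?a j) = 0" using ij by auto
    qed
  qed auto
  also have "\<dots> \<le> (\<Sum>(i, j)\<in>{..m} \<times> {..m}. ?a i * ?a j)"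
    by (rule sum_mono2) (auto simp: nn)
  also have "\<dots> = (\<Sum>i\<le>m. ?a i) * (\<Sum>i\<le>m. ?a i)"
    by (simp add: sum_product sum.cartesian_product)
  also have "\<dots> \<le> q * q"
    using Suc assms by (intro mult_mono sum_nonneg nn) auto
  finally show ?case by (simp add: algebra_simps)
qed

lemma summable_weight:
  assumes "0 \<le> q" "q \<le> 1/2"
  shows "summable (weight q)"
  using sum_weight_le[OF assms] weight_nonneg[of q] assms
  by (intro bounded_imp_summable[where B = q]) auto

text \<open>The sum \<open>G\<close> solves \<open>G = q (1 - q) + G\<^sup>2\<close>, whose roots are \<open>q\<close> and \<open>1 - q\<close>; the bound \<open>G \<le> q\<close>
  selects the smaller one.\<close>
lemma weight_sums:
  assumes "0 \<le> q" "q \<le> 1/2"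
  shows "weight q sums q"
proof -

  let ?G = "suminf (weight q)"
  have s: "summable (weight q)" by (rule summable_weight[OF assms])
  have sn: "summable (\<lambda>i. norm (weight q i))" using s weight_nonneg[of q] assms by simp
  have le: "?G \<le> q"   proof (rule suminf_le_const[OF s])
    fix n
    have "(\<Sum>i<n. weight q i) \<le> (\<Sum>i\<le>n. weight q i)"
      using assms by (intro sum_mono2 weight_nonneg) auto
    thus "(\<Sum>i<n. weight q i) \<le> q" using sum_weight_le[OF assms, of n] by simp
  qed
  have "(\<lambda>n. if n = 1 then q * (1 - q) else 0) sums (q * (1 - q))" by (rule sums_single)
  hence "(\<lambda>n. (if n = 1 then q * (1 - q) else 0) + (\<Sum>i\<le>n. weight q i * weight q (n - i)))
      sums (q * (1 - q) + ?G * ?G)"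
    by (intro sums_add Cauchy_product_sums sn)
  hence "weight q sums (q * (1 - q) + ?G * ?G)" by (subst (asm) weight_rec[symmetric])
  hence "?G = q * (1 - q) + ?G * ?G" by (simp add: sums_iff)
  hence "(?G - q) * (?G - (1 - q)) = 0" by (simp add: algebra_simps)
  hence "?G = q \<or> ?G = 1 - q" by simp
  hence "?G = q" using le assms by auto
  thus ?thesis using s by (simp add: sums_iff)
qed

text \<open>The sum of \<open>x\<close> to the power of the size, over all finite trees that contain the tree coded by \<open>t\<close>,
  at \<open>x = q (1 - q)\<close>. It is multiplicative over \<open>Join\<close>, which makes the laws below explicit.\<close>
definition extension_gf :: "real \<Rightarrow> code \<Rightarrow> real" where
  "extension_gf q t = (\<Sum>n. real (extensions t n) * (q * (1 - q)) ^ n)"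

lemma summable_extensions:
  assumes "0 \<le> q" "q \<le> 1/2"
  shows "summable (\<lambda>n. real (extensions t n) * (q * (1 - q)) ^ n)"
proof (rule summable_comparison_test'[OF summable_weight[OF assms]])
  fix n show "norm (real (extensions t n) * (q * (1 - q)) ^ n) \<le> weight q n"
    using assms extensions_le_tree_count[of t n]
    by (simp add: weight_def abs_mult mult_right_mono)
qed

lemma extension_gf_sums:
  assumes "0 \<le> q" "q \<le> 1/2"
  shows "(\<lambda>n. real (extensions t n) * (q * (1 - q)) ^ n) sums extension_gf q t"
  unfolding extension_gf_def using assms by (intro summable_sums summable_extensions)

lemma extension_gf_nonneg: "0 \<le> q \<Longrightarrow> q \<le> 1/2 \<Longrightarrow> 0 \<le> extension_gf q t"
  unfolding extension_gf_def by (intro suminf_nonneg summable_extensions) auto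

lemma extension_gf_Stump: "0 \<le> q \<Longrightarrow> q \<le> 1/2 \<Longrightarrow> extension_gf q Stump = q"
  using weight_sums[of q] by (simp add: extension_gf_def weight_def[abs_def] sums_iff)

lemma extension_gf_Join:
  assumes "0 \<le> q" "q \<le> 1/2"
  shows "extension_gf q (Join l r) = extension_gf q l * extension_gf q r"
proof -
  let ?x = "q * (1 - q)"
  have "(\<lambda>n. \<Sum>i\<le>n. (extensions l i * ?x ^ i) * (extensions r (n - i) * ?x ^ (n - i)))
      sums (extension_gf q l * extension_gf q r)"
    unfolding extension_gf_def
    using summable_extensions[OF assms] assms by (intro Cauchy_product_sums) auto
  also have "(\<lambda>n. \<Sum>i\<le>n. (extensions l i * ?x ^ i) * (extensions r (n - i) * ?x ^ (n - i)))
      = (\<lambda>n. real (extensions (Join l r) n) * ?x ^ n)"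
  proof
    fix n
    have "(extensions l i * ?x ^ i) * (extensions r (n - i) * ?x ^ (n - i))
        = real (extensions l i * extensions r (n - i)) * ?x ^ n" if "i \<le> n" for i
    proof -
      have "?x ^ n = ?x ^ i * ?x ^ (n - i)" using that by (simp flip: power_add)
      thus ?thesis by simp
    qed
    hence "(\<Sum>i\<le>n. (extensions l i * ?x ^ i) * (extensions r (n - i) * ?x ^ (n - i)))
      = (\<Sum>i\<le>n. real (extensions l i * extensions r (n - i)) * ?x ^ n)" by (intro sum.cong) auto
    thus "(\<Sum>i\<le>n. (extensions l i * ?x ^ i) * (extensions r (n - i) * ?x ^ (n - i)))
      = real (extensions (Join l r) n) * ?x ^ n"
      by (simp only: extensions_Join of_nat_sum sum_distrib_right)
  qed
  finally show ?thesis by (simp add: extension_gf_def sums_iff)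
qed

section \<open>Splitting a type monotonically\<close>

text \<open>A random tree is grown from a type: \<open>enat n\<close> asks for a uniform tree with \<open>n\<close> vertices, and \<open>\<infinity>\<close>
  for the infinite tree with parameter \<open>p = 1 - q\<close>. This is the probability that the first subtree has
  a finite type at most \<open>m\<close>. For type \<open>\<infinity>\<close> the first subtree has type \<open>m\<close> with probability
  \<open>weight q m\<close>, and the remaining mass \<open>1 - q\<close> belongs to \<open>\<infinity>\<close>. The value 1 for \<open>n \<le> 1\<close> gives both
  parts type 0, which stands for the empty tree.\<close>
definition split_cdf :: "real \<Rightarrow> enat \<Rightarrow> nat \<Rightarrow> real" where
  "split_cdf q s m = (case s of
     enat n \<Rightarrow> if n \<le> 1 then 1
       else (\<Sum>i\<le>m. real (tree_count i * tree_count (n - i))) / real (tree_count n)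
   | \<infinity> \<Rightarrow> \<Sum>i\<le>m. weight q i)"

lemma split_cdf_small [simp]: "n \<le> 1 \<Longrightarrow> split_cdf q (enat n) m = 1"
  by (simp add: split_cdf_def)

lemma sum_tree_count_prod: "2 \<le> n \<Longrightarrow>
    (\<Sum>i\<le>n. real (tree_count i * tree_count (n - i))) = real (tree_count n)"
  using tree_count_rec[of n] by (simp del: of_nat_mult flip: of_nat_sum)

lemma split_cdf_eq_1: "n \<le> Suc m \<Longrightarrow> split_cdf q (enat n) m = 1"
proof (cases "n \<le> 1")
  case False
  assume nm: "n \<le> Suc m"
  have "(\<Sum>i\<le>m. real (tree_count i * tree_count (n - i))) = (\<Sum>i<n. real (tree_count i * tree_count (n - i)))"
    using nm by (intro sum.mono_neutral_right) auto
  also have "\<dots> = (\<Sum>i\<le>n. real (tree_count i * tree_count (n - i)))"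
    by (intro sum.mono_neutral_left) (auto simp: not_less)
  finally show ?thesis using False sum_tree_count_prod[of n] tree_count_pos[of n] by (simp add: split_cdf_def)
qed auto

lemma split_cdf_0: "2 \<le> s \<Longrightarrow> split_cdf q s 0 = 0"
  by (cases s) (auto simp: split_cdf_def numeral_eq_enat)

lemma split_cdf_mono:
  assumes "0 \<le> q" "q \<le> 1/2" "m \<le> m'" shows "split_cdf q s m \<le> split_cdf q s m'"
  using assms weight_nonneg[of q]
  by (cases s) (auto simp: split_cdf_def intro!: divide_right_mono sum_mono2)

lemma split_cdf_le_1:
  assumes "0 \<le> q" "q \<le> 1/2" shows "split_cdf q s m \<le> 1"
proof (cases s)
  case (enat n)
  have "split_cdf q s m \<le> split_cdf q s (max m n)" by (intro split_cdf_mono assms) auto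
  also have "\<dots> = 1" unfolding enat by (rule split_cdf_eq_1) auto
  finally show ?thesis .
next
  case infinity
  thus ?thesis using sum_weight_le[OF assms, of m] assms by (simp add: split_cdf_def)
qed

text \<open>For \<open>i < n\<close>, log-convexity says that the ratio of \<open>tree_count (n - i)\<close> to \<open>tree_count n\<close> does not
  increase when \<open>n\<close> grows, so the sums can be compared term by term; if \<open>n \<le> m + 1\<close> the
  right-hand side is 1.\<close>
lemma split_cdf_Suc_le: 
  assumes "0 \<le> q" "q \<le> 1/2" shows "split_cdf q (enat (Suc n)) m \<le> split_cdf q (enat n) m"
proof (cases "n \<le> Suc m")
  case True thus ?thesis using split_cdf_eq_1[OF True] split_cdf_le_1[OF assms] by simp
next
  case False
  have pos: "0 < tree_count n" "0 < tree_count (Suc n)" using False by (auto intro: tree_count_pos)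
  have "real (tree_count i * tree_count (Suc n - i)) / tree_count (Suc n)
      \<le> real (tree_count i * tree_count (n - i)) / tree_count n" if "i \<le> m" for i
  proof -
    have "real (tree_count (Suc (n - i))) * tree_count n \<le> real (tree_count (n - i)) * tree_count (Suc n)"
      using that False by (intro tree_count_log_convex) auto
    hence "real (tree_count (Suc n - i)) / tree_count (Suc n) \<le> real (tree_count (n - i)) / tree_count n"
      using pos that False by (simp add: Suc_diff_le field_simps)
    from mult_left_mono[OF this, of "real (tree_count i)"] show ?thesis by simp
  qed
  thus ?thesis using False by (auto simp: split_cdf_def sum_divide_distrib intro!: sum_mono)
qed

text \<open>Term by term again: the count grows at most by the factor 4 per vertex, and \<open>q (1 - q) \<le> 1/4\<close>.\<close>
lemma split_cdf_infinity_le: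
  assumes "0 \<le> q" "q \<le> 1/2" shows "split_cdf q \<infinity> m \<le> split_cdf q' (enat n) m"
proof (cases "n \<le> Suc m")
  case True thus ?thesis using split_cdf_eq_1[OF True] split_cdf_le_1[OF assms] by simp
next
  case False
  have pos: "0 < tree_count n" using False by (auto intro: tree_count_pos)
  have x: "q * (1 - q) \<le> 1/4" "0 \<le> q * (1 - q)"
    using assms zero_le_square[of "q - 1/2"] by (simp_all add: algebra_simps mult_left_le)
  have "weight q i \<le> real (tree_count i * tree_count (n - i)) / tree_count n" if "i \<le> m" for i
  proof -
    have "real (tree_count n) \<le> 4 ^ i * real (tree_count (n - i))"
      using tree_count_add_le[of "n - i" i] that False by simp
    moreover have "(q * (1 - q)) ^ i \<le> (1/4) ^ i" using x by (intro power_mono) auto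
    hence "4 ^ i * (q * (1 - q)) ^ i \<le> 1" by (simp add: field_simps)
    hence "4 ^ i * real (tree_count (n - i)) * (q * (1 - q)) ^ i \<le> 1 * real (tree_count (n - i))"
      by (metis (no_types, opaque_lifting) mult.assoc mult.commute mult_right_mono of_nat_0_le_iff)
    ultimately have "real (tree_count n) * (q * (1 - q)) ^ i \<le> real (tree_count (n - i))"
      using mult_right_mono[of "real (tree_count n)" "4 ^ i * real (tree_count (n - i))" "(q * (1 - q)) ^ i"] x by simp
    hence "(q * (1 - q)) ^ i \<le> real (tree_count (n - i)) / tree_count n"
      using pos by (simp add: field_simps)
    from mult_left_mono[OF this, of "real (tree_count i)"] show ?thesis by (simp add: weight_def)
  qed
  thus ?thesis using False by (auto simp: split_cdf_def sum_divide_distrib intro!: sum_mono)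
qed

text \<open>The heart of the coupling: a larger type, or a smaller \<open>q\<close>, makes the first subtree
  stochastically larger. Between two infinite types this holds because \<open>q (1 - q)\<close> increases on the
  interval from 0 to 1/2.\<close>
lemma split_cdf_antimono:
  assumes q: "0 \<le> q'" "q' \<le> q" "q \<le> 1/2" and s: "s \<le> s'"
  shows "split_cdf q' s' m \<le> split_cdf q s m"
proof (cases s')
  case (enat n')
  then obtain n where n: "s = enat n" "n \<le> n'" using s by (cases s) auto
  from n(2) have "split_cdf q' (enat n') m \<le> split_cdf q' (enat n) m"
  proof (induction rule: dec_induct)
    case (step k)
    have "split_cdf q' (enat (Suc k)) m \<le> split_cdf q' (enat k) m"
      using q by (intro split_cdf_Suc_le) auto
    thus ?case using step.IH by (rule order.trans)
  qed simp
  thus ?thesis by (simp add: enat n split_cdf_def)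
next
  case infinity
  show ?thesis
  proof (cases s)
    case (enat n) thus ?thesis using infinity q split_cdf_infinity_le by simp
  next
    case infinity': infinity
    have "0 \<le> (q - q') * (1 - q - q')" using q by (intro mult_nonneg_nonneg) auto
    hence "q' * (1 - q') \<le> q * (1 - q)" by (simp add: algebra_simps)
    thus ?thesis using infinity infinity' q
      by (auto simp: split_cdf_def weight_def intro!: sum_mono mult_left_mono power_mono)
  qed
qed

lemma split_cdf_symmetric:
  assumes "2 \<le> n" "m < n"
  shows "1 - split_cdf q (enat n) m = split_cdf q (enat n) (n - Suc m)"
proof -
  let ?a = "\<lambda>i. real (tree_count i * tree_count (n - i))"
  have "(\<Sum>i\<le>n. ?a i) = (\<Sum>i\<le>m. ?a i) + (\<Sum>i\<in>{Suc m..n}. ?a i)"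
    using assms by (subst sum.union_disjoint[symmetric]) (auto intro!: sum.cong)
  also have "(\<Sum>i\<in>{Suc m..n}. ?a i) = (\<Sum>i\<le>n - Suc m. ?a i)"
    by (rule sum.reindex_bij_witness[of _ "\<lambda>i. n - i" "\<lambda>i. n - i"]) (use assms in auto)
  finally have "real (tree_count n) = (\<Sum>i\<le>m. ?a i) + (\<Sum>i\<le>n - Suc m. ?a i)"
    by (simp only: sum_tree_count_prod[OF assms(1)])
  moreover have "0 < real (tree_count n)" using assms tree_count_pos[of n] by simp
  moreover have "1 - a / c = b / c" if "c = a + b" "0 < c" for a b c :: real
    using that by (simp add: field_simps)
  ultimately have "1 - (\<Sum>i\<le>m. ?a i) / tree_count n = (\<Sum>i\<le>n - Suc m. ?a i) / tree_count n" by blast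
  moreover have "\<not> n \<le> 1" using assms(1) by simp
  ultimately show ?thesis unfolding split_cdf_def enat.case by (simp only: if_False)
qed

text \<open>Quantile functions of the types of the two parts, read from one number \<open>x\<close> in \<open>[0, 1)\<close>. The infimum
  of the empty set is \<open>\<infinity>\<close>, so no finite type fitting \<open>x\<close> means type \<open>\<infinity>\<close>. The right type is the
  left one read at \<open>1 - x\<close>; the inequality is strict in one definition and not in the other, so that the
  two finite parts of \<open>enat n\<close> add up to \<open>n\<close> for every \<open>x\<close>.\<close>
definition left_type :: "real \<Rightarrow> enat \<Rightarrow> real \<Rightarrow> enat" where
  "left_type q s x = (INF m\<in>{m. x < split_cdf q s m}. enat m)"

definition right_type :: "real \<Rightarrow> enat \<Rightarrow> real \<Rightarrow> enat" where
  "right_type q s x = (INF m\<in>{m. 1 - split_cdf q s m \<le> x}. enat m)"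

lemma left_type_mono:
  assumes "0 \<le> q'" "q' \<le> q" "q \<le> 1/2" "s \<le> s'" shows "left_type q s x \<le> left_type q' s' x"
  unfolding left_type_def
proof (rule INF_superset_mono[OF _ order.refl], rule subsetI)
  fix m assume "m \<in> {m. x < split_cdf q' s' m}"
  thus "m \<in> {m. x < split_cdf q s m}" using split_cdf_antimono[OF assms, of m] by simp
qed

lemma right_type_mono:
  assumes "0 \<le> q'" "q' \<le> q" "q \<le> 1/2" "s \<le> s'" shows "right_type q s x \<le> right_type q' s' x"
  unfolding right_type_def
proof (rule INF_superset_mono[OF _ order.refl], rule subsetI)
  fix m assume "m \<in> {m. 1 - split_cdf q' s' m \<le> x}"
  thus "m \<in> {m. 1 - split_cdf q s m \<le> x}" using split_cdf_antimono[OF assms, of m] by simp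
qed

lemma INF_enat_eqI:
  assumes "P k" "\<And>m. P m \<Longrightarrow> k \<le> m" shows "(INF m\<in>{m. P m}. enat m) = enat k"
proof (rule antisym)
  show "(INF m\<in>{m. P m}. enat m) \<le> enat k" using assms(1) by (intro INF_lower) simp
  show "enat k \<le> (INF m\<in>{m. P m}. enat m)" using assms(2) by (intro INF_greatest) simp
qed

lemma INF_enat_eq_iff: "(INF m\<in>{m. P m}. enat m) = enat k \<longleftrightarrow> P k \<and> (\<forall>m<k. \<not> P m)"
proof
  assume a: "(INF m\<in>{m. P m}. enat m) = enat k"
  have "\<exists>m. P m"
  proof (rule ccontr)
    assume "\<nexists>m. P m"
    hence "{m. P m} = {}" by blast
    thus False using a by (simp only: image_empty Inf_empty) (simp add: top_enat_def)
  qed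
  hence "(INF m\<in>{m. P m}. enat m) = enat (LEAST m. P m)"
    using LeastI_ex[of P] Least_le[of P] by (intro INF_enat_eqI[of P]) blast+
  hence "k = (LEAST m. P m)" using a by simp
  thus "P k \<and> (\<forall>m<k. \<not> P m)"
    using LeastI_ex[OF \<open>\<exists>m. P m\<close>] by (auto dest: not_less_Least)
next
  assume "P k \<and> (\<forall>m<k. \<not> P m)" thus "(INF m\<in>{m. P m}. enat m) = enat k"
    by (intro INF_enat_eqI[of P]) (blast, metis not_less)
qed

lemma left_type_small [simp]: "n \<le> 1 \<Longrightarrow> x < 1 \<Longrightarrow> left_type q (enat n) x = 0"
  unfolding left_type_def zero_enat_def by (subst INF_enat_eq_iff) auto

lemma right_type_small [simp]: "n \<le> 1 \<Longrightarrow> 0 \<le> x \<Longrightarrow> right_type q (enat n) x = 0"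
  unfolding right_type_def zero_enat_def by (subst INF_enat_eq_iff) auto

lemma left_type_nonzero: "2 \<le> s \<Longrightarrow> 0 \<le> x \<Longrightarrow> left_type q s x \<noteq> 0"
  unfolding left_type_def zero_enat_def by (subst INF_enat_eq_iff) (auto simp: split_cdf_0)

lemma right_type_nonzero: "2 \<le> s \<Longrightarrow> x < 1 \<Longrightarrow> right_type q s x \<noteq> 0"
  unfolding right_type_def zero_enat_def by (subst INF_enat_eq_iff) (auto simp: split_cdf_0)

lemma left_type_eqI:
  assumes "0 \<le> q" "q \<le> 1/2" "split_cdf q s i \<le> x" "x < split_cdf q s (Suc i)"
  shows "left_type q s x = enat (Suc i)"
  unfolding left_type_def
proof (rule INF_enat_eqI)
  fix m assume "x < split_cdf q s m"
  thus "Suc i \<le> m" using assms split_cdf_mono[of q m i s] by (cases "m \<le> i") auto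
qed (use assms in auto)

lemma right_type_eqI:
  assumes "0 \<le> q" "q \<le> 1/2" "1 - split_cdf q s (Suc i) \<le> x" "x < 1 - split_cdf q s i"
  shows "right_type q s x = enat (Suc i)"
  unfolding right_type_def
proof (rule INF_enat_eqI)
  fix m assume "1 - split_cdf q s m \<le> x"
  thus "Suc i \<le> m" using assms split_cdf_mono[of q m i s] by (cases "m \<le> i") auto
qed (use assms in auto)

text \<open>The two parts have sizes adding up to \<open>n\<close> because the split distribution of \<open>enat n\<close> is symmetric.\<close>
lemma split_types_finite:
  assumes q: "0 \<le> q" "q \<le> 1/2" and n: "2 \<le> n" "Suc i < n"
    and x: "split_cdf q (enat n) i \<le> x" "x < split_cdf q (enat n) (Suc i)"
  shows "left_type q (enat n) x = enat (Suc i)" "right_type q (enat n) x = enat (n - Suc i)"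
proof -
  show "left_type q (enat n) x = enat (Suc i)" using q x by (rule left_type_eqI)
  obtain j where j: "n - Suc i = Suc j" using n by (cases "n - Suc i") auto
  have "1 - split_cdf q (enat n) (Suc j) = split_cdf q (enat n) i"
    "1 - split_cdf q (enat n) j = split_cdf q (enat n) (Suc i)"
    using split_cdf_symmetric[of n "Suc j" q] split_cdf_symmetric[of n j q] n j
    by (auto simp: Suc_diff_Suc intro!: arg_cong[where f = "split_cdf q (enat n)"])
  thus "right_type q (enat n) x = enat (n - Suc i)" using q x unfolding j by (intro right_type_eqI) auto
qed

text \<open>At \<open>x \<in> [q, 1 - q)\<close> both this lemma and the next one apply, and both parts are infinite; for every
  other \<open>x\<close> exactly one of them applies.\<close>
lemma left_type_infinite:
  assumes "0 \<le> q" "q \<le> 1/2" "q \<le> x" shows "left_type q \<infinity> x = \<infinity>"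
proof -
  have "{m. x < split_cdf q \<infinity> m} = {}"
    using sum_weight_le[OF assms(1,2)] assms(3) by (auto simp: split_cdf_def not_less intro: order_trans)
  thus ?thesis by (simp only: left_type_def) (simp add: top_enat_def)
qed

lemma right_type_infinite:
  assumes "0 \<le> q" "q \<le> 1/2" "x < 1 - q" shows "right_type q \<infinity> x = \<infinity>"
proof -
  have "{m. 1 - split_cdf q \<infinity> m \<le> x} = {}"
  proof -
    have "x < 1 - split_cdf q \<infinity> m" for m
      using sum_weight_le[OF assms(1,2), of m] assms(3) by (auto simp: split_cdf_def)
    thus ?thesis by (auto simp: not_le)
  qed
  thus ?thesis by (simp only: right_type_def) (simp add: top_enat_def)
qed

section \<open>Random trees and their laws\<close>

lemma space_tree_space [simp]: "space tree_space = Pow vertices"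
  by (simp add: tree_space_def)

lemma measurable_into_tree_space:
  assumes "f \<in> space M \<rightarrow> Pow vertices"
    and "\<And>v. v \<in> vertices \<Longrightarrow> {\<omega> \<in> space M. v \<in> f \<omega>} \<in> sets M"
  shows "f \<in> M \<rightarrow>\<^sub>M tree_space"
  unfolding tree_space_def
proof (rule measurable_vimage_algebra2)
  show "(\<lambda>\<omega>. \<lambda>v\<in>vertices. v \<in> f \<omega>) \<in> M \<rightarrow>\<^sub>M (\<Pi>\<^sub>M v\<in>vertices. count_space (UNIV :: bool set))"
    using assms(2) by (intro measurable_restrict) (simp add: pred_def)
qed (use assms(1) in auto)

lemma sets_member_tree_space: "{T \<in> space tree_space. v \<in> T} \<in> sets tree_space"
proof (cases "v \<in> vertices")
  case True
  have "(\<lambda>T. \<lambda>v\<in>vertices. v \<in> T) \<in> tree_space \<rightarrow>\<^sub>M (\<Pi>\<^sub>M v\<in>vertices. count_space (UNIV :: bool set))"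
    unfolding tree_space_def by (intro measurable_vimage_algebra1) (auto simp: space_PiM)
  hence "(\<lambda>T. (\<lambda>v\<in>vertices. v \<in> T) v) \<in> tree_space \<rightarrow>\<^sub>M count_space (UNIV :: bool set)"
    by (rule measurable_compose[OF _ measurable_component_singleton[OF True]])
  thus ?thesis using True by (simp add: pred_def)
next
  case False
  hence "{T \<in> space tree_space. v \<in> T} = {}" by auto
  thus ?thesis by (simp only: sets.empty_sets)
qed

lemma measurable_member_tree_space [measurable (raw)]:
  assumes "f \<in> M \<rightarrow>\<^sub>M tree_space" shows "Measurable.pred M (\<lambda>\<omega>. v \<in> f \<omega>)"
proof -
  have "f -` {T \<in> space tree_space. v \<in> T} \<inter> space M = {\<omega> \<in> space M. v \<in> f \<omega>}"
    using measurable_space[OF assms] by auto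
  thus ?thesis
    using measurable_sets[OF assms sets_member_tree_space[of v]] by (simp add: pred_def)
qed

lemma measurable_subset_tree_space:
  assumes "f \<in> M \<rightarrow>\<^sub>M tree_space" shows "Measurable.pred M (\<lambda>\<omega>. A \<subseteq> f \<omega>)"
proof -
  have "Measurable.pred M (\<lambda>\<omega>. \<forall>v. v \<in> A \<longrightarrow> v \<in> f \<omega>)" using assms by measurable
  thus ?thesis by (simp add: subset_eq Ball_def)
qed

lemma measurable_tree_subset:
  assumes "f \<in> M \<rightarrow>\<^sub>M tree_space" "g \<in> M \<rightarrow>\<^sub>M tree_space" shows "Measurable.pred M (\<lambda>\<omega>. f \<omega> \<subseteq> g \<omega>)"
proof -
  have "Measurable.pred M (\<lambda>\<omega>. \<forall>v. v \<in> f \<omega> \<longrightarrow> v \<in> g \<omega>)" using assms by measurable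
  thus ?thesis by (simp add: subset_eq Ball_def)
qed

lemma measurable_tree_eq:
  assumes "f \<in> M \<rightarrow>\<^sub>M tree_space" shows "Measurable.pred M (\<lambda>\<omega>. f \<omega> = A)"
proof -
  have "Measurable.pred M (\<lambda>\<omega>. \<forall>v. v \<in> f \<omega> \<longleftrightarrow> v \<in> A)" using assms by measurable
  thus ?thesis by (simp add: set_eq_iff)
qed

lemma sets_superset: "{T \<in> space tree_space. A \<subseteq> T} \<in> sets tree_space"
  using measurable_subset_tree_space[OF measurable_ident[of tree_space], of A] by (simp add: pred_def)

lemma measurable_Union_tree_space:
  assumes "\<And>k. k \<in> K \<Longrightarrow> f k \<in> M \<rightarrow>\<^sub>M tree_space" "countable K"
  shows "(\<lambda>\<omega>. \<Union>k\<in>K. f k \<omega>) \<in> M \<rightarrow>\<^sub>M tree_space"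
proof (rule measurable_into_tree_space)
  show "(\<lambda>\<omega>. \<Union>k\<in>K. f k \<omega>) \<in> space M \<rightarrow> Pow vertices"
    using measurable_space[OF assms(1)] by fastforce
  fix v
  have "(\<Union>k\<in>K. {\<omega> \<in> space M. v \<in> f k \<omega>}) \<in> sets M"
    using measurable_member_tree_space[OF assms(1)] assms(2)
    by (intro sets.countable_UN'') (auto simp: pred_def)
  also have "(\<Union>k\<in>K. {\<omega> \<in> space M. v \<in> f k \<omega>}) = {\<omega> \<in> space M. v \<in> (\<Union>k\<in>K. f k \<omega>)}" by auto
  finally show "{\<omega> \<in> space M. v \<in> (\<Union>k\<in>K. f k \<omega>)} \<in> sets M" .
qed

lemma measurable_plane_closed:
  assumes "f \<in> M \<rightarrow>\<^sub>M tree_space"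
  shows "Measurable.pred M (\<lambda>\<omega>. plane_closed (f \<omega>))"
proof -
  have "Measurable.pred M (\<lambda>\<omega>. (\<forall>v. v \<in> f \<omega> \<longrightarrow> v \<in> vertices) \<and> [] \<in> f \<omega> \<and>
     (\<forall>v. v \<in> f \<omega> \<longrightarrow> v \<noteq> [] \<longrightarrow> butlast v \<in> f \<omega>) \<and>
     (\<forall>v. v \<in> f \<omega> \<longrightarrow> has_prev_sibling v \<longrightarrow> prev_sibling v \<in> f \<omega>))"
    using measurable_member_tree_space[OF assms]
    by (intro pred_intros_logic pred_intros_countable) (auto intro: pred_intros_logic)
  thus ?thesis unfolding plane_closed_def subset_eq Ball_def .
qed

lemma AE_plane_closed_distr:
  assumes "f \<in> M \<rightarrow>\<^sub>M tree_space" "\<And>\<omega>. \<omega> \<in> space M \<Longrightarrow> plane_closed (f \<omega>)"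
  shows "AE T in distr M tree_space f. plane_closed T"
proof (subst AE_distr_iff[OF assms(1)])
  show "{T \<in> space tree_space. plane_closed T} \<in> sets tree_space"
    using measurable_plane_closed[OF measurable_ident[of tree_space]] by (simp add: pred_def)
qed (simp add: assms(2))

text \<open>The events \<open>A \<subseteq> T\<close> with \<open>A\<close> finite are closed under intersection and generate the product
  \<open>\<sigma>\<close>-algebra.\<close>
lemma tree_measure_eqI:
  assumes M: "finite_measure M" "sets M = sets tree_space" and N: "sets N = sets tree_space"
    and eq: "\<And>A. finite A \<Longrightarrow> A \<subseteq> vertices \<Longrightarrow>
      emeasure M {T \<in> space tree_space. A \<subseteq> T} = emeasure N {T \<in> space tree_space. A \<subseteq> T}"
  shows "M = N"
proof -
  let ?\<Omega> = "Pow vertices"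
  let ?E = "{{T \<in> ?\<Omega>. A \<subseteq> T} | A. finite A \<and> A \<subseteq> vertices}"
  have E: "?E \<subseteq> Pow ?\<Omega>" by auto
  have "(\<lambda>T. T) \<in> sigma ?\<Omega> ?E \<rightarrow>\<^sub>M tree_space"
  proof (rule measurable_into_tree_space)
    fix v assume v: "v \<in> vertices"
    have "{T \<in> ?\<Omega>. v \<in> T} \<in> ?E" using v by (intro CollectI exI[of _ "{v}"]) simp
    hence "{T \<in> ?\<Omega>. v \<in> T} \<in> sets (sigma ?\<Omega> ?E)" unfolding sets_measure_of[OF E] by (rule sigma_sets.Basic)
    thus "{\<omega> \<in> space (sigma ?\<Omega> ?E). v \<in> \<omega>} \<in> sets (sigma ?\<Omega> ?E)"
      unfolding space_measure_of[OF E] .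
  qed (simp only: space_measure_of[OF E], simp)
  note id_meas = this
  have "S \<in> sigma_sets ?\<Omega> ?E" if "S \<in> sets tree_space" for S
  proof -
    have "(\<lambda>T. T) -` S \<inter> space (sigma ?\<Omega> ?E) \<in> sets (sigma ?\<Omega> ?E)"
      by (rule measurable_sets[OF id_meas that])
    moreover have "(\<lambda>T. T) -` S \<inter> ?\<Omega> = S"
      using sets.sets_into_space[OF that] by auto
    ultimately show ?thesis
      unfolding space_measure_of[OF E] sets_measure_of[OF E] by (simp only:)
  qed
  moreover have "sigma_sets ?\<Omega> ?E \<subseteq> sets tree_space"
  proof -
    have "?E \<subseteq> sets tree_space"
    proof
      fix S assume "S \<in> ?E"
      then obtain A where "S = {T \<in> space tree_space. A \<subseteq> T}" by auto
      moreover have "Measurable.pred tree_space (\<lambda>T. A \<subseteq> T)" by (rule measurable_subset_tree_space) simp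
      ultimately show "S \<in> sets tree_space" by (simp only: pred_def)
    qed
    thus ?thesis using sets.sigma_sets_subset[of ?E tree_space] by simp
  qed
  ultimately have gen: "sets tree_space = sigma_sets ?\<Omega> ?E" by blast
  have fin: "emeasure M ?\<Omega> \<noteq> \<infinity>" using finite_measure.emeasure_finite[OF M(1)] by simp
  show ?thesis
  proof (rule measure_eqI_generator_eq[where E = ?E and \<Omega> = ?\<Omega> and A = "\<lambda>_. ?\<Omega>"])
    show "Int_stable ?E"
    proof (rule Int_stableI)
      fix a b assume "a \<in> ?E" "b \<in> ?E"
      then obtain A B where "a = {T \<in> ?\<Omega>. A \<subseteq> T}" "b = {T \<in> ?\<Omega>. B \<subseteq> T}"
        "finite A" "finite B" "A \<subseteq> vertices" "B \<subseteq> vertices" by blast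
      thus "a \<inter> b \<in> ?E" by (intro CollectI exI[of _ "A \<union> B"]) auto
    qed
    show "emeasure M X = emeasure N X" if X: "X \<in> ?E" for X
    proof -
      obtain A where "X = {T \<in> space tree_space. A \<subseteq> T}" "finite A" "A \<subseteq> vertices"
        using X unfolding space_tree_space by blast
      thus ?thesis by (simp only: eq)
    qed
    have "?\<Omega> \<in> ?E" by (intro CollectI exI[of _ "{}"]) auto
    thus "range (\<lambda>_::nat. ?\<Omega>) \<subseteq> ?E" by (simp only: image_subset_iff ball_UNIV) simp
    show "sets M = sigma_sets ?\<Omega> ?E" "sets N = sigma_sets ?\<Omega> ?E" using M(2) N gen by (simp_all only:)
    show "emeasure M ?\<Omega> \<noteq> \<infinity>" by (rule fin)
    show "?E \<subseteq> Pow ?\<Omega>" by (rule E)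
    show "(\<Union>i::nat. ?\<Omega>) = ?\<Omega>" by simp
  qed
qed

lemma plane_tree_measure_eqI:
  assumes M: "finite_measure M" "sets M = sets tree_space" "AE T in M. plane_closed T"
    and N: "sets N = sets tree_space" "AE T in N. plane_closed T"
    and eq: "\<And>t. emeasure M {T \<in> space tree_space. plane t \<subseteq> T} = emeasure N {T \<in> space tree_space. plane t \<subseteq> T}"
  shows "M = N"
proof (rule tree_measure_eqI[OF M(1,2) N(1)])
  fix A assume A: "finite A" "A \<subseteq> vertices"
  obtain t where t: "\<forall>T. plane_closed T \<longrightarrow> (plane t \<subseteq> T \<longleftrightarrow> A \<subseteq> T)"
    using code_of_finite_set[OF A] by blast
  have *: "emeasure L {T \<in> space tree_space. A \<subseteq> T} = emeasure L {T \<in> space tree_space. plane t \<subseteq> T}"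
    if L: "sets L = sets tree_space" "AE T in L. plane_closed T" for L
  proof (rule emeasure_eq_AE)
    from L(2) show "AE x in L. (x \<in> {T \<in> space tree_space. A \<subseteq> T}) = (x \<in> {T \<in> space tree_space. plane t \<subseteq> T})"
    proof (rule AE_mp, intro AE_I2 impI)
      fix T assume "plane_closed T"
      from t[rule_format, OF this] show "(T \<in> {T \<in> space tree_space. A \<subseteq> T}) = (T \<in> {T \<in> space tree_space. plane t \<subseteq> T})"
        unfolding mem_Collect_eq by blast
    qed
    have "Measurable.pred tree_space (\<lambda>T. B \<subseteq> T)" for B
      using measurable_subset_tree_space[OF measurable_ident[of tree_space], of B] by (simp add: id_def)
    hence B: "{T \<in> space tree_space. B \<subseteq> T} \<in> sets L" for B unfolding L(1) pred_def .
    show "{T \<in> space tree_space. A \<subseteq> T} \<in> sets L" by (rule B)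
    show "{T \<in> space tree_space. plane t \<subseteq> T} \<in> sets L" by (rule B)
  qed
  show "emeasure M {T \<in> space tree_space. A \<subseteq> T} = emeasure N {T \<in> space tree_space. A \<subseteq> T}"
    unfolding *[OF M(2,3)] *[OF N] by (rule eq)
qed

section \<open>Growing a tree from independent uniform variables\<close>

definition unif :: "real measure" where
  "unif = restrict_space lborel {0..<1}"

lemma space_unif [simp]: "space unif = {0..<1}"
  by (simp add: unif_def)

interpretation unif: prob_space unif
  unfolding unif_def by (rule prob_space_restrict_space) auto

definition randomness :: "(bool list \<Rightarrow> real) measure" where
  "randomness = (\<Pi>\<^sub>M w\<in>UNIV. unif)"

interpretation rand: product_prob_space "\<lambda>_ :: bool list. unif" UNIV ..

interpretation randomness: prob_space randomness
  unfolding randomness_def by (rule prob_space_PiM) (rule unif.prob_space_axioms)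

interpretation randomness2: pair_sigma_finite randomness randomness ..

lemma randomness_range: "u \<in> space randomness \<Longrightarrow> 0 \<le> u w \<and> u w < 1"
  by (auto simp: randomness_def space_PiM PiE_iff)

text \<open>The words index the nodes of the infinite binary tree of successive splits: \<open>False\<close> leads to the
  first subtree and \<open>True\<close> to the remainder.\<close>
definition assemble :: "real \<times> (bool list \<Rightarrow> real) \<times> (bool list \<Rightarrow> real) \<Rightarrow> bool list \<Rightarrow> real" where
  "assemble = (\<lambda>(x, a, b) w. case w of [] \<Rightarrow> x | c # w' \<Rightarrow> if c then b w' else a w')"

lemma measurable_randomness_component [measurable]: "(\<lambda>u. u w) \<in> randomness \<rightarrow>\<^sub>M unif"
  unfolding randomness_def by (rule measurable_component_singleton) simp

lemma measurable_assemble [measurable]: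
  "assemble \<in> unif \<Otimes>\<^sub>M (randomness \<Otimes>\<^sub>M randomness) \<rightarrow>\<^sub>M randomness"
  unfolding randomness_def
proof (rule measurable_PiM_single')
  fix w :: "bool list"
  show "(\<lambda>z. assemble z w) \<in> unif \<Otimes>\<^sub>M (Pi\<^sub>M UNIV (\<lambda>w. unif) \<Otimes>\<^sub>M Pi\<^sub>M UNIV (\<lambda>w. unif)) \<rightarrow>\<^sub>M unif"
    unfolding randomness_def[symmetric]
    by (cases w) (auto simp: assemble_def split_beta)
qed (auto simp: space_PiM space_pair_measure assemble_def PiE_iff split: list.split)

text \<open>The variable at the root and the variables in the two halves are independent, and each half is
  distributed like the whole: both measures give the same mass to every finite-dimensional box.\<close>
lemma distr_assemble:
  "distr (unif \<Otimes>\<^sub>M (randomness \<Otimes>\<^sub>M randomness)) randomness assemble = randomness"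
  (is "?D = _")
proof -
  have "?D = (\<Pi>\<^sub>M w\<in>UNIV. unif)"
  proof (rule rand.PiM_eq)
    show "sets ?D = sets (\<Pi>\<^sub>M w\<in>UNIV. unif)" by (simp add: randomness_def)
    fix J :: "bool list set" and F
    assume J: "finite J" and F: "\<And>j. j \<in> J \<Longrightarrow> F j \<in> sets unif"
    let ?J = "\<lambda>c. {w. c # w \<in> J}"
    let ?A = "\<lambda>c. {a \<in> space randomness. \<forall>w\<in>?J c. a w \<in> F (c # w)}"
    let ?X = "{x \<in> space unif. [] \<in> J \<longrightarrow> x \<in> F []}"
    have finJ: "finite (?J c)" for c
      using finite_vimageI[OF J, of "(#) c"] by (simp add: vimage_def)
    have Adef: "emeasure randomness (?A c) = (\<Prod>w\<in>?J c. emeasure unif (F (c # w)))" for c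
      unfolding randomness_def by (rule rand.emeasure_PiM_Collect) (use finJ F in auto)
    have Aset: "?A c \<in> sets randomness" for c
    proof (intro sets.sets_Collect_finite_All finJ)
      fix w assume "w \<in> ?J c"
      hence "F (c # w) \<in> sets unif" using F by auto
      thus "{a \<in> space randomness. a w \<in> F (c # w)} \<in> sets randomness" by measurable
    qed
    have Xset: "?X \<in> sets unif"
    proof (cases "[] \<in> J")
      case True
      hence "F [] \<in> sets unif" using F by auto
      thus ?thesis using True by measurable
    next
      case False
      hence "?X = space unif" by auto
      thus ?thesis by (simp only: sets.top)
    qed
    have X: "emeasure unif ?X = (\<Prod>w\<in>J \<inter> {[]}. emeasure unif (F w))"
    proof (cases "[] \<in> J")
      case True
      hence "F [] \<subseteq> space unif" using F[of "[]"] sets.sets_into_space by blast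
      hence "?X = F []" using True by auto
      thus ?thesis using True by simp
    next
      case False
      hence "?X = space unif" by auto
      moreover have "J \<inter> {[]} = {}" using False by auto
      ultimately show ?thesis using unif.emeasure_space_1 by (simp only: prod.empty)
    qed
    have B: "prod_emb UNIV (\<lambda>_. unif) J (Pi\<^sub>E J F) = {u \<in> space randomness. \<forall>w\<in>J. u w \<in> F w}"
      unfolding randomness_def
      by (intro set_eqI, simp only: prod_emb_iff restrict_PiE_iff mem_Collect_eq space_PiM PiE_iff)
         (auto simp: Pi_iff)
    have Bset: "{u \<in> space randomness. \<forall>w\<in>J. u w \<in> F w} \<in> sets randomness"
    proof (intro sets.sets_Collect_finite_All J)
      fix w assume "w \<in> J"
      hence "F w \<in> sets unif" using F by auto
      thus "{a \<in> space randomness. a w \<in> F w} \<in> sets randomness" by measurable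
    qed
    have pre: "assemble -` {u \<in> space randomness. \<forall>w\<in>J. u w \<in> F w} \<inter>
        space (unif \<Otimes>\<^sub>M (randomness \<Otimes>\<^sub>M randomness)) = ?X \<times> (?A False \<times> ?A True)"
    proof (intro set_eqI)
      fix z :: "real \<times> (bool list \<Rightarrow> real) \<times> (bool list \<Rightarrow> real)"
      obtain x a b where z: "z = (x, a, b)" by (cases z)
      have "(\<forall>w\<in>J. assemble z w \<in> F w) \<longleftrightarrow>
          ([] \<in> J \<longrightarrow> x \<in> F []) \<and> (\<forall>w. False # w \<in> J \<longrightarrow> a w \<in> F (False # w)) \<and>
          (\<forall>w. True # w \<in> J \<longrightarrow> b w \<in> F (True # w))" (is "?L \<longleftrightarrow> ?R")
      proof
        assume l: ?L
        from l have "[] \<in> J \<longrightarrow> x \<in> F []" using bspec[OF l, of "[]"] by (simp add: z assemble_def)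
        moreover have "False # w \<in> J \<longrightarrow> a w \<in> F (False # w)" for w
          using bspec[OF l, of "False # w"] by (simp add: z assemble_def)
        moreover have "True # w \<in> J \<longrightarrow> b w \<in> F (True # w)" for w
          using bspec[OF l, of "True # w"] by (simp add: z assemble_def)
        ultimately show ?R by blast
      next
        assume r: ?R
        show ?L
        proof
          fix w assume "w \<in> J"
          thus "assemble z w \<in> F w" using r
            by (cases w) (auto simp: z assemble_def)
        qed
      qed
      moreover have "assemble z \<in> space randomness" if "z \<in> space (unif \<Otimes>\<^sub>M (randomness \<Otimes>\<^sub>M randomness))"
        using that by (rule measurable_space[OF measurable_assemble])
      ultimately show "z \<in> assemble -` {u \<in> space randomness. \<forall>w\<in>J. u w \<in> F w} \<inter>
          space (unif \<Otimes>\<^sub>M (randomness \<Otimes>\<^sub>M randomness)) \<longleftrightarrow> z \<in> ?X \<times> (?A False \<times> ?A True)"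
        by (auto simp: z space_pair_measure)
    qed
    have "emeasure ?D (prod_emb UNIV (\<lambda>_. unif) J (Pi\<^sub>E J F))
        = emeasure (unif \<Otimes>\<^sub>M (randomness \<Otimes>\<^sub>M randomness)) (?X \<times> (?A False \<times> ?A True))"
      unfolding B pre[symmetric] by (rule emeasure_distr[OF measurable_assemble Bset])
    also have "\<dots> = emeasure unif ?X * (emeasure randomness (?A False) * emeasure randomness (?A True))"
    proof -
      have "emeasure (randomness \<Otimes>\<^sub>M randomness) (?A False \<times> ?A True)
        = emeasure randomness (?A False) * emeasure randomness (?A True)"
        by (intro randomness.emeasure_pair_measure_Times Aset)
      moreover have "emeasure (unif \<Otimes>\<^sub>M (randomness \<Otimes>\<^sub>M randomness)) (?X \<times> (?A False \<times> ?A True))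
        = emeasure unif ?X * emeasure (randomness \<Otimes>\<^sub>M randomness) (?A False \<times> ?A True)"
        by (rule sigma_finite_measure.emeasure_pair_measure_Times
              [OF randomness2.sigma_finite_measure_axioms Xset pair_measureI[OF Aset Aset]])
      ultimately show ?thesis by (simp only:)
    qed
    also have "\<dots> = (\<Prod>w\<in>J \<inter> {[]}. emeasure unif (F w)) *
        ((\<Prod>w\<in>(#) False ` ?J False. emeasure unif (F w)) * (\<Prod>w\<in>(#) True ` ?J True. emeasure unif (F w)))"
    proof -
      have "(\<Prod>w\<in>(#) c ` ?J c. emeasure unif (F w)) = (\<Prod>w\<in>?J c. emeasure unif (F (c # w)))" for c
        by (subst prod.reindex) (simp_all add: inj_on_def comp_def)
      thus ?thesis by (simp only: X Adef)
    qed
    also have "\<dots> = (\<Prod>w\<in>(J \<inter> {[]}) \<union> ((#) False ` ?J False \<union> (#) True ` ?J True). emeasure unif (F w))"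
    proof -
      have "finite (J \<inter> {[]})" "finite ((#) c ` ?J c)" for c using J finJ by auto
      moreover have "(J \<inter> {[]}) \<inter> ((#) False ` ?J False \<union> (#) True ` ?J True) = {}"
        "(#) False ` ?J False \<inter> (#) True ` ?J True = {}" by auto
      ultimately show ?thesis by (simp only: prod.union_disjoint finite_Un simp_thms)
    qed
    also have "(J \<inter> {[]}) \<union> ((#) False ` ?J False \<union> (#) True ` ?J True) = J"
    proof (intro set_eqI)
      fix w show "w \<in> (J \<inter> {[]}) \<union> ((#) False ` ?J False \<union> (#) True ` ?J True) \<longleftrightarrow> w \<in> J"
      proof (cases w)
        case (Cons c w') thus ?thesis by (cases c) auto
      qed auto
    qed
    finally show "emeasure ?D (prod_emb UNIV (\<lambda>_. unif) J (Pi\<^sub>E J F)) = (\<Prod>j\<in>J. emeasure unif (F j))" .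
  qed
  thus ?thesis by (simp add: randomness_def)
qed

text \<open>Whether \<open>v\<close> belongs to the tree of type \<open>s\<close>. The number \<open>u []\<close> splits the type, and each part grows
  from its own half of the randomness; the first child of the root opens the first subtree, the later
  children lie in the remainder. The recursion is on \<open>v\<close>, so infinite types need no limit.\<close>
function grown_at :: "real \<Rightarrow> enat \<Rightarrow> (bool list \<Rightarrow> real) \<Rightarrow> vertex \<Rightarrow> bool" where
  "grown_at q s u [] \<longleftrightarrow> s \<noteq> 0"
| "grown_at q s u (0 # w) \<longleftrightarrow> False"
| "grown_at q s u (Suc 0 # w) \<longleftrightarrow> grown_at q (left_type q s (u [])) (\<lambda>b. u (False # b)) w"
| "grown_at q s u (Suc (Suc i) # w) \<longleftrightarrow> grown_at q (right_type q s (u [])) (\<lambda>b. u (True # b)) (Suc i # w)"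
  by pat_completeness auto
termination by (relation "Wellfounded.measure (\<lambda>(q, s, u, v). length v + sum_list v)") auto

definition grown_tree :: "real \<Rightarrow> enat \<Rightarrow> (bool list \<Rightarrow> real) \<Rightarrow> vertex set" where
  "grown_tree q s u = {v. grown_at q s u v}"

text \<open>Both type functions are monotone in the type and antimonotone in \<open>q\<close>, and all trees read the same
  random numbers, so the monotonicity passes from the types to the trees, for every outcome.\<close>
lemma grown_mono:
  assumes "grown_at q s u v" "0 \<le> q'" "q' \<le> q" "q \<le> 1/2" "s \<le> s'"
  shows "grown_at q' s' u v"
  using assms
proof (induction q s u v arbitrary: s' rule: grown_at.induct)
  case (1 q s u) thus ?case by auto
next
  case (3 q s u w)
  have "left_type q s (u []) \<le> left_type q' s' (u [])" using 3 by (intro left_type_mono)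
  thus ?case using 3 by simp
next
  case (4 q s u i w)
  have "right_type q s (u []) \<le> right_type q' s' (u [])" using 4 by (intro right_type_mono)
  thus ?case using 4 by simp
qed auto

lemma grown_tree_mono:
  "0 \<le> q' \<Longrightarrow> q' \<le> q \<Longrightarrow> q \<le> 1/2 \<Longrightarrow> s \<le> s' \<Longrightarrow> grown_tree q s u \<subseteq> grown_tree q' s' u"
  using grown_mono by (auto simp: grown_tree_def)

lemma grown_in_vertices: "grown_at q s u v \<Longrightarrow> v \<in> vertices"
  by (induction q s u v rule: grown_at.induct) (auto simp: vertices_def)

lemma grown_tree_subset_vertices: "grown_tree q s u \<subseteq> vertices"
  using grown_in_vertices by (auto simp: grown_tree_def)

lemma enat_le_1_or_2_le: "s \<le> 1 \<or> 2 \<le> (s :: enat)"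
  by (cases s) (auto simp: one_enat_def numeral_eq_enat)

lemma left_type_eq_0_iff: "0 \<le> x \<Longrightarrow> x < 1 \<Longrightarrow> left_type q s x = 0 \<longleftrightarrow> s \<le> 1"
proof -
  assume x: "0 \<le> x" "x < 1"
  show ?thesis
  proof
    assume "left_type q s x = 0" thus "s \<le> 1" using left_type_nonzero[of s x q] x enat_le_1_or_2_le[of s] by blast
  next
    assume "s \<le> 1"
    then obtain n where "s = enat n" "n \<le> 1" by (cases s) (auto simp: one_enat_def)
    thus "left_type q s x = 0" using x by simp
  qed
qed

lemma right_type_eq_0_iff: "0 \<le> x \<Longrightarrow> x < 1 \<Longrightarrow> right_type q s x = 0 \<longleftrightarrow> s \<le> 1"
proof -
  assume x: "0 \<le> x" "x < 1"
  show ?thesis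
  proof
    assume "right_type q s x = 0" thus "s \<le> 1" using right_type_nonzero[of s x q] x enat_le_1_or_2_le[of s] by blast
  next
    assume "s \<le> 1"
    then obtain n where "s = enat n" "n \<le> 1" by (cases s) (auto simp: one_enat_def)
    thus "right_type q s x = 0" using x by simp
  qed
qed

lemma grown_Nil_if: "grown_at q s u v \<Longrightarrow> (\<And>w. 0 \<le> u w \<and> u w < 1) \<Longrightarrow> s \<noteq> 0"
proof (induction q s u v rule: grown_at.induct)
  case (3 q s u w)
  thus ?case using left_type_eq_0_iff[of "u []" q s] by auto
next
  case (4 q s u i w)
  thus ?case using right_type_eq_0_iff[of "u []" q s] by auto
qed auto

lemma grown_butlast:
  "grown_at q s u v \<Longrightarrow> (\<And>w. 0 \<le> u w \<and> u w < 1) \<Longrightarrow> v \<noteq> [] \<Longrightarrow> grown_at q s u (butlast v)"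
proof (induction q s u v rule: grown_at.induct)
  case (3 q s u w)
  show ?case
  proof (cases "w = []")
    case True thus ?thesis using grown_Nil_if[OF 3(2,3)] by simp
  next
    case False thus ?thesis using 3 by simp
  qed
next
  case (4 q s u i w)
  show ?case
  proof (cases "w = []")
    case True thus ?thesis using grown_Nil_if[OF 4(2,3)] by simp
  next
    case False thus ?thesis using 4 by simp
  qed
qed auto

lemma grown_prev_sibling:
  "grown_at q s u v \<Longrightarrow> (\<And>w. 0 \<le> u w \<and> u w < 1) \<Longrightarrow> has_prev_sibling v \<Longrightarrow> grown_at q s u (prev_sibling v)"
proof (induction q s u v rule: grown_at.induct)
  case (3 q s u w)
  hence w: "has_prev_sibling w" "prev_sibling (Suc 0 # w) = Suc 0 # prev_sibling w"
    by (auto simp: has_prev_sibling_def prev_sibling_def split: if_splits)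
  thus ?case using 3 by simp
next
  case (4 q s u i w)
  let ?r = "right_type q s (u [])"
  have r: "grown_at q ?r (\<lambda>b. u (True # b)) (Suc i # w)" using 4(2) by simp
  consider "w = []" "i = 0" | j where "w = []" "i = Suc j" | "w \<noteq> []" by (cases i) auto
  thus ?case
  proof cases
    case 1
    have "?r \<noteq> 0" using r 4(3) by (intro grown_Nil_if[OF r]) auto
    hence "left_type q s (u []) \<noteq> 0"
      using left_type_eq_0_iff[of "u []" q s] right_type_eq_0_iff[of "u []" q s] 4(3)[of "[]"] by auto
    thus ?thesis using 1 by (simp add: prev_sibling_def)
  next
    case 2
    thus ?thesis using 4(1)[OF r 4(3)] by (simp add: has_prev_sibling_def prev_sibling_def)
  next
    case 3
    hence "has_prev_sibling (Suc i # w)" using 4(4) by (auto simp: has_prev_sibling_def)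
    from 4(1)[OF r 4(3) this] show ?thesis using 3 by (auto simp: prev_sibling_def)
  qed
qed (auto simp: has_prev_sibling_def)

text \<open>For \<open>x \<in> [0, 1)\<close> the two parts of a type are empty together, namely when the type is at most 1.
  Hence the remainder is empty whenever the first child of the root is missing, and then there are no
  later children either.\<close>
lemma plane_closed_grown_tree:
  assumes "u \<in> space randomness" "s \<noteq> 0"
  shows "plane_closed (grown_tree q s u)"
proof -
  have u: "0 \<le> u w \<and> u w < 1" for w using randomness_range[OF assms(1)] .
  show ?thesis
    using grown_tree_subset_vertices grown_butlast[OF _ u] grown_prev_sibling[OF _ u] assms(2)
    by (auto simp: plane_closed_def grown_tree_def)
qed

lemma measurable_INF_enat:
  assumes "\<And>m. {x \<in> space M. P m x} \<in> sets M"
  shows "(\<lambda>x. INF m\<in>{m. P m x}. enat m) \<in> M \<rightarrow>\<^sub>M count_space UNIV"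
proof -
  have P [measurable]: "Measurable.pred M (P m)" for m using assms by (simp add: pred_def)
  have k: "{x \<in> space M. (INF m\<in>{m. P m x}. enat m) = enat k} \<in> sets M" for k
    unfolding INF_enat_eq_iff by measurable
  have inf: "{x \<in> space M. (INF m\<in>{m. P m x}. enat m) = \<infinity>}
      = space M - (\<Union>k. {x \<in> space M. (INF m\<in>{m. P m x}. enat m) = enat k})"
  proof (intro set_eqI)
    fix x show "x \<in> {x \<in> space M. (INF m\<in>{m. P m x}. enat m) = \<infinity>} \<longleftrightarrow>
      x \<in> space M - (\<Union>k. {x \<in> space M. (INF m\<in>{m. P m x}. enat m) = enat k})"
      by (cases "INF m\<in>{m. P m x}. enat m") auto
  qed
  have "(\<lambda>x. INF m\<in>{m. P m x}. enat m) -` {a} \<inter> space M \<in> sets M" for a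
  proof -
    have "(\<lambda>x. INF m\<in>{m. P m x}. enat m) -` {a} \<inter> space M = {x \<in> space M. (INF m\<in>{m. P m x}. enat m) = a}"
      by auto
    moreover have "{x \<in> space M. (INF m\<in>{m. P m x}. enat m) = a} \<in> sets M"
    proof (cases a)
      case (enat k) thus ?thesis using k by simp
    next
      case infinity
      have "space M - (\<Union>k. {x \<in> space M. (INF m\<in>{m. P m x}. enat m) = enat k}) \<in> sets M" using k by blast
      thus ?thesis using inf infinity by simp
    qed
    ultimately show ?thesis by (simp only:)
  qed
  thus ?thesis by (subst measurable_count_space_eq_countable) auto
qed

lemma measurable_left_type [measurable]: "left_type q s \<in> unif \<rightarrow>\<^sub>M count_space UNIV"
  unfolding left_type_def[abs_def]
proof (rule measurable_INF_enat)
  fix m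
  have "{x \<in> space lborel. x < split_cdf q s m} \<in> sets borel" by measurable
  thus "{x \<in> space unif. x < split_cdf q s m} \<in> sets unif"
    unfolding unif_def by (auto simp: sets_restrict_space intro!: image_eqI[where x = "{x \<in> space lborel. x < split_cdf q s m}"])
qed

lemma measurable_right_type [measurable]: "right_type q s \<in> unif \<rightarrow>\<^sub>M count_space UNIV"
  unfolding right_type_def[abs_def]
proof (rule measurable_INF_enat)
  fix m
  have "{x \<in> space lborel. 1 - split_cdf q s m \<le> x} \<in> sets borel" by measurable
  thus "{x \<in> space unif. 1 - split_cdf q s m \<le> x} \<in> sets unif"
    unfolding unif_def by (auto simp: sets_restrict_space intro!: image_eqI[where x = "{x \<in> space lborel. 1 - split_cdf q s m \<le> x}"])
qed

lemma measurable_subrandomness [measurable]: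
  "(\<lambda>u b. u (c # b)) \<in> randomness \<rightarrow>\<^sub>M randomness"
proof -
  have "(\<lambda>u b. u (c # b)) \<in> randomness \<rightarrow>\<^sub>M (\<Pi>\<^sub>M w\<in>UNIV. unif)"
    by (rule measurable_PiM_single') (auto simp: randomness_def space_PiM)
  thus ?thesis by (simp add: randomness_def)
qed

lemma measurable_grown: "Measurable.pred randomness (\<lambda>u. grown_at q s u v)"
proof (induction "length v + sum_list v" arbitrary: s v rule: less_induct)
  case less
  consider "v = []" | w where "v = 0 # w" | w where "v = Suc 0 # w" | i w where "v = Suc (Suc i) # w"
    by (cases v rule: path_code.cases) auto
  thus ?case
  proof cases
    case 3
    have "Measurable.pred randomness (\<lambda>u. grown_at q s' u w)" for s' using 3 by (intro less) auto
    hence a: "Measurable.pred randomness (\<lambda>u. grown_at q s' (\<lambda>b. u (False # b)) w)" for s'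
      by (rule measurable_compose[OF measurable_subrandomness])
    have "Measurable.pred randomness (\<lambda>u. grown_at q (left_type q s (u [])) (\<lambda>b. u (False # b)) w)"
      by (rule measurable_compose_countable[OF a]) measurable
    thus ?thesis using 3 by simp
  next
    case 4
    have "Measurable.pred randomness (\<lambda>u. grown_at q s' u (Suc i # w))" for s' using 4 by (intro less) auto
    hence a: "Measurable.pred randomness (\<lambda>u. grown_at q s' (\<lambda>b. u (True # b)) (Suc i # w))" for s'
      by (rule measurable_compose[OF measurable_subrandomness])
    have "Measurable.pred randomness (\<lambda>u. grown_at q (right_type q s (u [])) (\<lambda>b. u (True # b)) (Suc i # w))"
      by (rule measurable_compose_countable[OF a]) measurable
    thus ?thesis using 4 by simp
  qed auto
qed

lemma measurable_grown_tree [measurable]: "grown_tree q s \<in> randomness \<rightarrow>\<^sub>M tree_space"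
  using measurable_grown grown_tree_subset_vertices
  by (intro measurable_into_tree_space) (auto simp: grown_tree_def pred_def)

definition cover_prob :: "real \<Rightarrow> enat \<Rightarrow> code \<Rightarrow> ennreal" where
  "cover_prob q s t = emeasure randomness {u \<in> space randomness. plane t \<subseteq> grown_tree q s u}"

lemma sets_cover: "{u \<in> space randomness. plane t \<subseteq> grown_tree q s u} \<in> sets randomness"
proof -
  have "Measurable.pred randomness (\<lambda>u. plane t \<subseteq> grown_tree q s u)"
    by (rule measurable_subset_tree_space[OF measurable_grown_tree])
  thus ?thesis by (simp add: pred_def)
qed

lemma emeasure_distr_grown_tree:
  "emeasure (distr randomness tree_space (grown_tree q s)) {T \<in> space tree_space. plane t \<subseteq> T} = cover_prob q s t"
proof -
  have "grown_tree q s -` {T \<in> space tree_space. plane t \<subseteq> T} \<inter> space randomness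
      = {u \<in> space randomness. plane t \<subseteq> grown_tree q s u}"
    using grown_tree_subset_vertices by auto
  thus ?thesis unfolding cover_prob_def
    by (subst emeasure_distr[OF measurable_grown_tree sets_superset]) simp
qed

lemma cover_prob_Stump: "s \<noteq> 0 \<Longrightarrow> cover_prob q s Stump = 1"
  by (simp add: cover_prob_def grown_tree_def randomness.emeasure_space_1)

lemma Join_covered_iff:
  assumes u: "assemble (x, a, b) \<in> space randomness" and x: "0 \<le> x" "x < 1"
  shows "plane (Join l r) \<subseteq> grown_tree q s (assemble (x, a, b)) \<longleftrightarrow>
    plane l \<subseteq> grown_tree q (left_type q s x) a \<and> plane r \<subseteq> grown_tree q (right_type q s x) b"
proof -
  have sub: "(\<lambda>w. assemble (x, a, b) (False # w)) = a" "(\<lambda>w. assemble (x, a, b) (True # w)) = b"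
    "assemble (x, a, b) [] = x" by (auto simp: assemble_def)
  have f: "first_subtree (grown_tree q s (assemble (x, a, b))) = grown_tree q (left_type q s x) a"
    by (auto simp: first_subtree_def grown_tree_def sub)
  have r: "w \<in> remainder (grown_tree q s (assemble (x, a, b))) \<longleftrightarrow> w \<in> grown_tree q (right_type q s x) b"
    if "w \<in> vertices" "w \<noteq> []" for w
  proof -
    from that obtain j w' where j: "w = j # w'" "1 \<le> j" by (cases w) (auto simp: vertices_def)
    then obtain i where "w = Suc i # w'" by (cases j) auto
    thus ?thesis using that by (simp add: remainder_def grown_tree_def sub)
  qed
  have nil: "[] \<in> remainder (grown_tree q s (assemble (x, a, b))) \<longleftrightarrow> s \<noteq> 0"
    "[] \<in> grown_tree q s' a \<longleftrightarrow> s' \<noteq> 0" "[] \<in> grown_tree q s' b \<longleftrightarrow> s' \<noteq> 0" for s'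
    by (auto simp: remainder_def grown_tree_def vertices_def)
  have l0: "left_type q s x = 0 \<longleftrightarrow> s \<le> 1" "right_type q s x = 0 \<longleftrightarrow> s \<le> 1"
    using x by (auto simp: left_type_eq_0_iff right_type_eq_0_iff)
  show ?thesis
  proof (cases "s \<le> 1")
    case True
    hence "[] \<notin> grown_tree q (left_type q s x) a" using nil(2) l0(1) by simp
    hence "\<not> plane l \<subseteq> grown_tree q (left_type q s x) a" using Nil_in_plane[of l] by blast
    thus ?thesis by (simp only: plane_Join_subset_iff f) simp
  next
    case False
    have "w \<in> remainder (grown_tree q s (assemble (x, a, b))) \<longleftrightarrow> w \<in> grown_tree q (right_type q s x) b"
      if "w \<in> plane r" for w
    proof (cases "w = []")
      case True
      have "s \<noteq> 0" using False by auto
      thus ?thesis using True nil(1) nil(3)[of "right_type q s x"] l0(2) False by simp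
    next
      case w: False
      have "w \<in> vertices" using that plane_subset_vertices by blast
      thus ?thesis using r w by blast
    qed
    hence "plane r \<subseteq> remainder (grown_tree q s (assemble (x, a, b))) \<longleftrightarrow> plane r \<subseteq> grown_tree q (right_type q s x) b"
      unfolding subset_iff by blast
    thus ?thesis by (simp only: plane_Join_subset_iff f)
  qed
qed

text \<open>Given the variable at the root, the two parts grow independently from their types.\<close>
lemma cover_prob_Join:
  "cover_prob q s (Join l r) =
    (\<integral>\<^sup>+x. cover_prob q (left_type q s x) l * cover_prob q (right_type q s x) r \<partial>unif)"
proof -
  let ?PP = "randomness \<Otimes>\<^sub>M randomness"
  let ?S = "{u \<in> space randomness. plane (Join l r) \<subseteq> grown_tree q s u}"
  let ?C = "\<lambda>s t. {u \<in> space randomness. plane t \<subseteq> grown_tree q s u}"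
  let ?B = "assemble -` ?S \<inter> space (unif \<Otimes>\<^sub>M ?PP)"

  have "cover_prob q s (Join l r) = emeasure (distr (unif \<Otimes>\<^sub>M ?PP) randomness assemble) ?S"
    by (simp only: cover_prob_def distr_assemble)
  also have "\<dots> = emeasure (unif \<Otimes>\<^sub>M ?PP) ?B"
    by (rule emeasure_distr[OF measurable_assemble sets_cover])
  also have "\<dots> = (\<integral>\<^sup>+x. emeasure ?PP (Pair x -` ?B) \<partial>unif)"
    by (rule sigma_finite_measure.emeasure_pair_measure_alt[OF randomness2.sigma_finite_measure_axioms])
       (rule measurable_sets[OF measurable_assemble sets_cover])
  also have "\<dots> = (\<integral>\<^sup>+x. emeasure ?PP (?C (left_type q s x) l \<times> ?C (right_type q s x) r) \<partial>unif)"
  proof (rule nn_integral_cong)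
    fix x assume x: "x \<in> space unif"
    have "Pair x -` ?B = ?C (left_type q s x) l \<times> ?C (right_type q s x) r"
    proof (intro set_eqI)
      fix z :: "(bool list \<Rightarrow> real) \<times> (bool list \<Rightarrow> real)"
      obtain a b where z: "z = (a, b)" by (cases z)
      show "z \<in> Pair x -` ?B \<longleftrightarrow> z \<in> ?C (left_type q s x) l \<times> ?C (right_type q s x) r"
      proof (cases "a \<in> space randomness \<and> b \<in> space randomness")
        case True
        hence m: "assemble (x, a, b) \<in> space randomness"
          using x by (intro measurable_space[OF measurable_assemble]) (auto simp: space_pair_measure)
        have x': "0 \<le> x" "x < 1" using x by auto
        show ?thesis using True m x unfolding z
          by (simp add: space_pair_measure Join_covered_iff[OF m x'] del: plane.simps)
      qed (auto simp: z space_pair_measure)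
    qed
    thus "emeasure ?PP (Pair x -` ?B) = emeasure ?PP (?C (left_type q s x) l \<times> ?C (right_type q s x) r)"
      by simp
  qed
  also have "\<dots> = (\<integral>\<^sup>+x. cover_prob q (left_type q s x) l * cover_prob q (right_type q s x) r \<partial>unif)"
    unfolding cover_prob_def by (intro nn_integral_cong randomness.emeasure_pair_measure_Times sets_cover)
  finally show ?thesis .
qed

section \<open>The law of the grown tree\<close>

lemma cover_prob_0: "cover_prob q 0 t = 0"
proof -
  have "\<not> plane t \<subseteq> grown_tree q 0 u" for u
    using Nil_in_plane[of t] by (auto simp: grown_tree_def simp del: Nil_in_plane)
  thus ?thesis by (simp add: cover_prob_def)
qed

lemma nn_integral_unif: "(\<integral>\<^sup>+x. f x \<partial>unif) = (\<integral>\<^sup>+x. f x * indicator {0..<1} x \<partial>lborel)"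
  unfolding unif_def by (rule nn_integral_restrict_space) simp

text \<open>The uniform variable falls with probability \<open>tree_count i * tree_count (n - i) / tree_count n\<close> into
  the interval on which the sizes of the parts are \<open>i\<close> and \<open>n - i\<close>, so the recursion for the
  probability is the convolution \<open>extensions_Join\<close>.\<close>
lemma cover_prob_enat:
  assumes q: "0 \<le> q" "q \<le> 1/2" and n: "1 \<le> n"
  shows "cover_prob q (enat n) t = ennreal (real (extensions t n) / real (tree_count n))"
  using n
proof (induction t arbitrary: n)
  case Stump
  thus ?case using tree_count_pos[of n] by (subst cover_prob_Stump) (auto simp: zero_enat_def)
next
  case (Join l r)
  show ?case
  proof (cases "n = 1")
    case True
    have "cover_prob q (left_type q (enat n) x) l = 0" if "0 \<le> x" "x < 1" for x
      using that True by (simp add: cover_prob_0)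
    hence "cover_prob q (enat n) (Join l r) = (\<integral>\<^sup>+x. 0 \<partial>unif)"
      unfolding cover_prob_Join by (intro nn_integral_cong) auto
    moreover have "extensions (Join l r) n = 0" using True by (simp add: extensions_Join)
    ultimately show ?thesis by simp
  next
    case False
    define F where "F = split_cdf q (enat n)"
    define c where "c i = cover_prob q (enat (Suc i)) l * cover_prob q (enat (n - Suc i)) r" for i
    have F0: "F 0 = 0" and F1: "F (n - 1) = 1"
      using False Join.prems split_cdf_0[of "enat n" q] split_cdf_eq_1[of n "n - 1" q]
      by (auto simp: F_def numeral_eq_enat)
    have Fmono: "F i \<le> F j" if "i \<le> j" for i j
      using q that unfolding F_def by (rule split_cdf_mono)
    have "cover_prob q (left_type q (enat n) x) l * cover_prob q (right_type q (enat n) x) r * indicator {0..<1} x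
        = (\<Sum>i<n - 1. c i * indicator {F i..<F (Suc i)} x)" for x
    proof (cases "x \<in> {0..<1}")
      case True
      \<comment> \<open>The cut points \<open>F 0 = 0, \<dots>, F (n - 1) = 1\<close> divide \<open>[0, 1)\<close>; find the interval of \<open>x\<close>.\<close>
      define m where "m = (LEAST m. x < F m)"
      have m: "x < F m" using True F1 unfolding m_def by (intro LeastI[of "\<lambda>m. x < F m" "n - 1"]) auto
      have m0: "m \<noteq> 0" using m F0 True by (intro notI) simp
      then obtain i where i: "m = Suc i" by (cases m) auto
      have "\<not> x < F i" using not_less_Least[of i "\<lambda>m. x < F m"] i by (simp add: m_def)
      hence xi: "F i \<le> x" "x < F (Suc i)" using m i by auto
      have "m \<le> n - 1" unfolding m_def using True F1 by (intro Least_le) auto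
      hence i': "i < n - 1" using i by simp
      have "c j * indicator {F j..<F (Suc j)} x = (if j = i then c i else 0)" for j
        using xi Fmono[of "Suc j" i] Fmono[of "Suc i" j] by (cases j i rule: linorder_cases) auto
      hence "(\<Sum>i<n - 1. c i * indicator {F i..<F (Suc i)} x) = c i" using i' by simp
      moreover have "left_type q (enat n) x = enat (Suc i)" "right_type q (enat n) x = enat (n - Suc i)"
        using split_types_finite[of q n i x] q False Join.prems i' xi by (auto simp: F_def)
      ultimately show ?thesis using True by (simp add: c_def)
    next
      case False
      have "x \<notin> {F i..<F (Suc i)}" if "i < n - 1" for i
        using Fmono[of 0 i] Fmono[of "Suc i" "n - 1"] F0 F1 that False by auto
      thus ?thesis using False by simp
    qed
    hence "cover_prob q (enat n) (Join l r) = (\<integral>\<^sup>+x. (\<Sum>i<n - 1. c i * indicator {F i..<F (Suc i)} x) \<partial>lborel)"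
      unfolding cover_prob_Join nn_integral_unif by (simp only:)
    also have "\<dots> = (\<Sum>i<n - 1. c i * ennreal (F (Suc i) - F i))"
    proof -
      have "emeasure lborel {F i..<F (Suc i)} = ennreal (F (Suc i) - F i)" for i
        using Fmono[of i "Suc i"] by simp
      thus ?thesis
        by (simp only: nn_integral_sum borel_measurable_times_ennreal borel_measurable_indicator
          borel_measurable_const sets_lborel atLeastLessThan_borel nn_integral_cmult_indicator)
    qed
    also have "\<dots> = (\<Sum>i<n - 1. ennreal (real (extensions l (Suc i) * extensions r (n - Suc i)) / tree_count n))"
    proof (rule sum.cong[OF refl])
      fix i assume "i \<in> {..<n - 1}"
      hence i: "Suc i < n" by auto
      have pos: "0 < tree_count (Suc i)" "0 < tree_count (n - Suc i)"
        using i by (auto intro: tree_count_pos)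
      have "F (Suc i) - F i = real (tree_count (Suc i) * tree_count (n - Suc i)) / tree_count n"
        using i by (simp add: F_def split_cdf_def add_divide_distrib)
      moreover have "c i = ennreal (real (extensions l (Suc i)) / tree_count (Suc i) *
          (real (extensions r (n - Suc i)) / tree_count (n - Suc i)))"
      proof -
        have "cover_prob q (enat (Suc i)) l = ennreal (real (extensions l (Suc i)) / tree_count (Suc i))"
          "cover_prob q (enat (n - Suc i)) r = ennreal (real (extensions r (n - Suc i)) / tree_count (n - Suc i))"
          using Join.IH(1)[of "Suc i"] Join.IH(2)[of "n - Suc i"] i by auto
        thus ?thesis unfolding c_def by (simp only: ennreal_mult divide_nonneg_nonneg of_nat_0_le_iff)
      qed
      ultimately have "c i * ennreal (F (Suc i) - F i) = ennreal (real (extensions l (Suc i)) / tree_count (Suc i) *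
          (real (extensions r (n - Suc i)) / tree_count (n - Suc i)) *
          (real (tree_count (Suc i) * tree_count (n - Suc i)) / tree_count n))"
        by (simp only: ennreal_mult divide_nonneg_nonneg mult_nonneg_nonneg of_nat_0_le_iff)
      also have "real (extensions l (Suc i)) / tree_count (Suc i) *
          (real (extensions r (n - Suc i)) / tree_count (n - Suc i)) *
          (real (tree_count (Suc i) * tree_count (n - Suc i)) / tree_count n)
        = real (extensions l (Suc i) * extensions r (n - Suc i)) / tree_count n"
        using pos by (simp add: field_simps)
      finally show "c i * ennreal (F (Suc i) - F i) = ennreal (real (extensions l (Suc i) * extensions r (n - Suc i)) / tree_count n)" .
    qed
    also have "\<dots> = ennreal ((\<Sum>i<n - 1. real (extensions l (Suc i) * extensions r (n - Suc i))) / tree_count n)"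
      by (simp add: sum_divide_distrib)
    also have "(\<Sum>i<n - 1. real (extensions l (Suc i) * extensions r (n - Suc i))) = real (extensions (Join l r) n)"
    proof -
      have "(\<Sum>i<n - 1. extensions l (Suc i) * extensions r (n - Suc i))
          = (\<Sum>i\<in>{1..<n}. extensions l i * extensions r (n - i))"
        using False Join.prems
        by (intro sum.reindex_bij_witness[of _ "\<lambda>i. i - 1" Suc]) auto
      also have "\<dots> = extensions (Join l r) n"
        unfolding extensions_Join by (intro sum.mono_neutral_left) (auto simp: not_less_eq_eq)
      finally show ?thesis by (simp only: of_nat_sum[symmetric])
    qed
    finally show ?thesis .
  qed
qed

lemma extension_gf_le:
  assumes "0 \<le> q" "q \<le> 1/2" shows "extension_gf q t \<le> (1 - q) ^ leaves t"
proof (induction t)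
  case Stump thus ?case using assms by (simp add: extension_gf_Stump)
next
  case (Join l r)
  thus ?case using assms extension_gf_nonneg[OF assms]
    by (simp only: extension_gf_Join leaves.simps power_add mult_mono')
qed

lemma suminf_cover_prob_weight:
  assumes q: "0 \<le> q" "q \<le> 1/2"
  shows "(\<Sum>i. cover_prob q (enat (Suc i)) t * ennreal (weight q (Suc i))) = ennreal (extension_gf q t)"
proof -
  let ?f = "\<lambda>n. real (extensions t n) * (q * (1 - q)) ^ n"
  have "cover_prob q (enat (Suc i)) t * ennreal (weight q (Suc i)) = ennreal (?f (Suc i))" for i
  proof -
    have "0 < tree_count (Suc i)" by (rule tree_count_pos) simp
    hence "real (extensions t (Suc i)) / tree_count (Suc i) * weight q (Suc i) = ?f (Suc i)"
      by (simp add: weight_def)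
    moreover have "cover_prob q (enat (Suc i)) t = ennreal (real (extensions t (Suc i)) / tree_count (Suc i))"
      using q by (intro cover_prob_enat) auto
    ultimately show ?thesis
      by (metis divide_nonneg_nonneg ennreal_mult' of_nat_0_le_iff)
  qed
  moreover have "(\<lambda>i. ?f (Suc i)) sums extension_gf q t"
    unfolding sums_Suc_iff[of ?f] using extension_gf_sums[OF q, of t] by simp
  ultimately have s: "summable (\<lambda>i. ?f (Suc i))" "(\<Sum>i. ?f (Suc i)) = extension_gf q t"
    and c: "\<And>i. cover_prob q (enat (Suc i)) t * ennreal (weight q (Suc i)) = ennreal (?f (Suc i))"
    by (auto simp only: sums_iff)
  have "(\<Sum>i. ennreal (?f (Suc i))) = ennreal (\<Sum>i. ?f (Suc i))"
    using q s(1) by (intro suminf_ennreal2) auto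
  thus ?thesis by (simp only: c s(2))
qed

text \<open>Write \<open>p = 1 - q\<close>, \<open>H = extension_gf q\<close>, and \<open>A\<close> for the claimed probability. The first part is
  finite and the second infinite with contribution \<open>H l * A r\<close>, the other way round with contribution
  \<open>A l * H r\<close>, and both are infinite with probability \<open>p - q\<close>. As \<open>p ^ leaves t = H t + A t * (p - q)\<close>,
  multiplying these equations for \<open>l\<close> and \<open>r\<close> gives the one for \<open>Join l r\<close>.\<close>
lemma cover_prob_infinity:
  assumes q: "0 \<le> q" "q < 1/2"
  shows "cover_prob q \<infinity> t = ennreal (((1 - q) ^ leaves t - extension_gf q t) / (1 - 2 * q))"
proof (induction t)
  case Stump
  thus ?case using q by (subst cover_prob_Stump) (auto simp: extension_gf_Stump)
next
  case (Join l r)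
  have q': "q \<le> 1/2" using q by simp
  define F where "F = split_cdf q \<infinity>"
  define A where "A t = ((1 - q) ^ leaves t - extension_gf q t) / (1 - 2 * q)" for t
  define H where "H = extension_gf q"
  have A: "0 \<le> A t" for t using q extension_gf_le[OF q(1) q'] by (simp add: A_def)
  have H: "0 \<le> H t" for t unfolding H_def by (rule extension_gf_nonneg[OF q(1) q'])
  define a where "a i = cover_prob q (enat (Suc i)) l * ennreal (A r)" for i
  define b where "b i = cover_prob q (enat (Suc i)) r * ennreal (A l)" for i
  have F0: "F 0 = 0" by (simp add: F_def split_cdf_def)
  have FSuc: "F (Suc i) - F i = weight q (Suc i)" for i by (simp add: F_def split_cdf_def)
  have Fmono: "F i \<le> F j" if "i \<le> j" for i j
    using q(1) q' that unfolding F_def by (rule split_cdf_mono)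
  have Fle: "F i \<le> q" for i using sum_weight_le[OF q(1) q'] by (simp add: F_def split_cdf_def)
  have Flim: "F \<longlonglongrightarrow> q"
    using weight_sums[OF q(1) q'] by (simp add: F_def split_cdf_def[abs_def] sums_def_le)
  have ex: "\<exists>m. y < F m" if "y < q" for y
    using order_tendstoD(1)[OF Flim that] by (auto simp: eventually_sequentially)
  have "AE x in lborel. cover_prob q (left_type q \<infinity> x) l * cover_prob q (right_type q \<infinity> x) r * indicator {0..<1} x
      = (\<Sum>i. a i * indicator {F i..<F (Suc i)} x) + (\<Sum>i. b i * indicator {1 - F (Suc i)..<1 - F i} x)
        + ennreal (A l * A r) * indicator {q..<1 - q} x"
    \<comment> \<open>The intervals cover \<open>[0, 1)\<close> except possibly for the point \<open>1 - q\<close>, a limit of cut points.\<close>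
    using AE_lborel_singleton[of "1 - q"]
  proof eventually_elim
    fix x :: real assume x: "x \<noteq> 1 - q"
    have z1: "(\<Sum>i. a i * indicator {F i..<F (Suc i)} x) = 0" if "x < 0 \<or> q \<le> x"
    proof -
      have "x \<notin> {F i..<F (Suc i)}" for i using that Fmono[of 0 i] F0 Fle[of "Suc i"] by auto
      thus ?thesis by simp
    qed
    have z2: "(\<Sum>i. b i * indicator {1 - F (Suc i)..<1 - F i} x) = 0" if "1 \<le> x \<or> x < 1 - q"
    proof -
      have "x \<notin> {1 - F (Suc i)..<1 - F i}" for i using that Fmono[of 0 i] F0 Fle[of "Suc i"] by auto
      thus ?thesis by simp
    qed
    consider "x < 0" | "0 \<le> x" "x < q" | "q \<le> x" "x < 1 - q" | "1 - q < x" "x < 1" | "1 \<le> x" 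
      using x by linarith
    thus "cover_prob q (left_type q \<infinity> x) l * cover_prob q (right_type q \<infinity> x) r * indicator {0..<1} x
      = (\<Sum>i. a i * indicator {F i..<F (Suc i)} x) + (\<Sum>i. b i * indicator {1 - F (Suc i)..<1 - F i} x)
        + ennreal (A l * A r) * indicator {q..<1 - q} x"
    proof cases
      case 1 thus ?thesis using z1 z2 q by simp
    next
      case 2
      define m where "m = (LEAST m. x < F m)"
      have m: "x < F m" unfolding m_def using ex[OF 2(2)] by (rule LeastI_ex)
      have "m \<noteq> 0" using m F0 2 by (intro notI) simp
      then obtain i where i: "m = Suc i" by (cases m) auto
      have "\<not> x < F i" using not_less_Least[of i "\<lambda>m. x < F m"] i by (simp add: m_def)
      hence xi: "F i \<le> x" "x < F (Suc i)" using m i by auto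
      have "a j * indicator {F j..<F (Suc j)} x = (if j = i then a j else 0)" for j
        using xi Fmono[of "Suc j" i] Fmono[of "Suc i" j] by (cases j i rule: linorder_cases) auto
      hence "(\<Sum>j. a j * indicator {F j..<F (Suc j)} x) = a i"
        using sums_single[of i a] by (simp add: sums_iff)
      moreover have "left_type q \<infinity> x = enat (Suc i)" using xi q by (intro left_type_eqI) (auto simp: F_def)
      moreover have "right_type q \<infinity> x = \<infinity>" using 2 q by (intro right_type_infinite) auto
      ultimately show ?thesis using 2 q z2 Join.IH(2) by (simp add: a_def A_def)
    next
      case 3
      have "left_type q \<infinity> x = \<infinity>" "right_type q \<infinity> x = \<infinity>"
        using 3 q by (auto intro!: left_type_infinite right_type_infinite)
      moreover have "cover_prob q \<infinity> l * cover_prob q \<infinity> r = ennreal (A l * A r)"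
        using A[of l] A[of r] unfolding Join.IH A_def[symmetric] by (simp add: ennreal_mult')
      ultimately show ?thesis using 3 q z1 z2 by simp
    next
      case 4
      define m where "m = (LEAST m. 1 - x \<le> F m)"
      have "\<exists>m. 1 - x \<le> F m" using ex[of "1 - x"] 4 by (auto intro: less_imp_le)
      hence m: "1 - x \<le> F m" unfolding m_def by (rule LeastI_ex)
      have "m \<noteq> 0" using m F0 4 by (intro notI) simp
      then obtain i where i: "m = Suc i" by (cases m) auto
      have "\<not> 1 - x \<le> F i" using not_less_Least[of i "\<lambda>m. 1 - x \<le> F m"] i by (simp add: m_def)
      hence xi: "1 - F (Suc i) \<le> x" "x < 1 - F i" using m i by auto
      have "b j * indicator {1 - F (Suc j)..<1 - F j} x = (if j = i then b j else 0)" for j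
        using xi Fmono[of "Suc j" i] Fmono[of "Suc i" j] by (cases j i rule: linorder_cases) auto
      hence "(\<Sum>j. b j * indicator {1 - F (Suc j)..<1 - F j} x) = b i"
        using sums_single[of i b] by (simp add: sums_iff)
      moreover have "right_type q \<infinity> x = enat (Suc i)" using xi q by (intro right_type_eqI) (auto simp: F_def)
      moreover have "left_type q \<infinity> x = \<infinity>" using 4 q by (intro left_type_infinite) auto
      ultimately show ?thesis using 4 q z1 Join.IH(1) by (simp add: b_def A_def mult.commute)
    next
      case 5 thus ?thesis using z1 z2 q by simp
    qed
  qed
  hence "cover_prob q \<infinity> (Join l r) = (\<integral>\<^sup>+x. (\<Sum>i. a i * indicator {F i..<F (Suc i)} x)
      + (\<Sum>i. b i * indicator {1 - F (Suc i)..<1 - F i} x) + ennreal (A l * A r) * indicator {q..<1 - q} x \<partial>lborel)"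
    unfolding cover_prob_Join nn_integral_unif by (rule nn_integral_cong_AE)
  also have "\<dots> = (\<Sum>i. a i * ennreal (weight q (Suc i))) + (\<Sum>i. b i * ennreal (weight q (Suc i)))
      + ennreal (A l * A r) * ennreal (1 - 2 * q)"
  proof -
    have "emeasure lborel {F i..<F (Suc i)} = ennreal (weight q (Suc i))"
      "emeasure lborel {1 - F (Suc i)..<1 - F i} = ennreal (weight q (Suc i))" for i
      using Fmono[of i "Suc i"] FSuc[of i] by simp_all
    moreover have "emeasure lborel {q..<1 - q} = ennreal (1 - 2 * q)" using q by simp
    ultimately show ?thesis
      by (simp only: nn_integral_add borel_measurable_add borel_measurable_suminf_order
        nn_integral_suminf borel_measurable_times_ennreal borel_measurable_indicator
        borel_measurable_const sets_lborel atLeastLessThan_borel nn_integral_cmult_indicator)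
  qed
  also have "(\<Sum>i. a i * ennreal (weight q (Suc i))) = ennreal (H l) * ennreal (A r)"
  proof -
    have "a i * ennreal (weight q (Suc i)) = cover_prob q (enat (Suc i)) l * ennreal (weight q (Suc i)) * ennreal (A r)" for i
      by (simp add: a_def mult_ac)
    thus ?thesis by (simp only: ennreal_suminf_multc suminf_cover_prob_weight[OF q(1) q'] H_def)
  qed
  also have "(\<Sum>i. b i * ennreal (weight q (Suc i))) = ennreal (H r) * ennreal (A l)"
  proof -
    have "b i * ennreal (weight q (Suc i)) = cover_prob q (enat (Suc i)) r * ennreal (weight q (Suc i)) * ennreal (A l)" for i
      by (simp add: b_def mult_ac)
    thus ?thesis by (simp only: ennreal_suminf_multc suminf_cover_prob_weight[OF q(1) q'] H_def)
  qed
  also have "ennreal (H l) * ennreal (A r) + ennreal (H r) * ennreal (A l) + ennreal (A l * A r) * ennreal (1 - 2 * q)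
      = ennreal (H l * A r + H r * A l + A l * A r * (1 - 2 * q))"
    using A H q by (simp add: ennreal_mult')
  also have "H l * A r + H r * A l + A l * A r * (1 - 2 * q) = A (Join l r)"
  proof -
    have p: "(1 - q) ^ leaves t = H t + A t * (1 - 2 * q)" for t
      using q by (simp add: A_def H_def)
    have "H (Join l r) = H l * H r" unfolding H_def by (rule extension_gf_Join[OF q(1) q'])
    moreover have "(1 - q) ^ leaves (Join l r) = (1 - q) ^ leaves l * (1 - q) ^ leaves r"
      by (simp add: power_add)
    ultimately have "H l * H r + A (Join l r) * (1 - 2 * q)
        = (H l + A l * (1 - 2 * q)) * (H r + A r * (1 - 2 * q))"
      by (simp only: p)
    hence "A (Join l r) * (1 - 2 * q) = (H l * A r + H r * A l + A l * A r * (1 - 2 * q)) * (1 - 2 * q)"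
      by algebra
    thus ?thesis using q by simp
  qed
  finally show ?case by (simp only: A_def)
qed

section \<open>The geometric Galton-Watson tree\<close>

lemma Nil_in_gw_tree [simp]: "[] \<in> gw_tree X"
  by (auto simp: gw_tree_def intro: exI[of _ 0])

lemma snoc_in_gw_tree_iff:
  "v @ [i] \<in> gw_tree X \<longleftrightarrow> v \<in> gw_tree X \<and> 1 \<le> i \<and> enat i \<le> X v"
proof
  assume "v @ [i] \<in> gw_tree X"
  then obtain n where n: "v @ [i] \<in> gw_generation X n" by (auto simp: gw_tree_def)
  then obtain m where "n = Suc m" by (cases n) auto
  with n show "v \<in> gw_tree X \<and> 1 \<le> i \<and> enat i \<le> X v" by (auto simp: gw_tree_def)
next
  assume a: "v \<in> gw_tree X \<and> 1 \<le> i \<and> enat i \<le> X v"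
  then obtain n where "v \<in> gw_generation X n" by (auto simp: gw_tree_def)
  with a have "v @ [i] \<in> gw_generation X (Suc n)" by auto
  thus "v @ [i] \<in> gw_tree X" unfolding gw_tree_def by blast
qed

lemma gw_tree_subset_vertices: "gw_tree X \<subseteq> vertices"
proof
  fix v show "v \<in> gw_tree X \<Longrightarrow> v \<in> vertices"
  proof (induction v rule: rev_induct)
    case (snoc i v) thus ?case by (auto simp: snoc_in_gw_tree_iff vertices_def)
  qed (simp add: vertices_def)
qed

lemma plane_closed_gw_tree: "plane_closed (gw_tree X)"
proof -
  have "butlast v \<in> gw_tree X" if "v \<in> gw_tree X" for v
    using that by (cases v rule: rev_cases) (auto simp: snoc_in_gw_tree_iff)
  moreover have "prev_sibling v \<in> gw_tree X" if v: "v \<in> gw_tree X" "has_prev_sibling v" for v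
  proof -
    obtain w i where w: "v = w @ [i]" using v(2) by (cases v rule: rev_cases) (auto simp: has_prev_sibling_def)
    have i: "w \<in> gw_tree X" "enat i \<le> X w" "2 \<le> i"
      using v by (auto simp: w snoc_in_gw_tree_iff has_prev_sibling_def)
    have "enat (i - 1) \<le> X w" by (rule order.trans[OF _ i(2)]) simp
    thus ?thesis using i by (simp add: w prev_sibling_def snoc_in_gw_tree_iff)
  qed
  ultimately show ?thesis using gw_tree_subset_vertices by (auto simp: plane_closed_def)
qed

abbreviation offspring_space :: "real \<Rightarrow> (vertex \<Rightarrow> enat) measure" where
  "offspring_space p \<equiv> \<Pi>\<^sub>M v\<in>vertices. measure_pmf (offspring_pmf p)"

lemma measurable_gw_tree: "gw_tree \<in> offspring_space p \<rightarrow>\<^sub>M tree_space"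
proof (rule measurable_into_tree_space)
  fix v :: vertex
  have "Measurable.pred (offspring_space p) (\<lambda>X. v \<in> gw_tree X)"
  proof (induction v rule: rev_induct)
    case (snoc i v)
    show ?case
    proof (cases "v \<in> vertices")
      case True
      have "Measurable.pred (offspring_space p) (\<lambda>X. enat i \<le> X v)"
        by (rule measurable_compose[OF measurable_component_singleton[OF True]]) simp
      thus ?thesis using snoc unfolding snoc_in_gw_tree_iff by (intro pred_intros_logic) auto
    next
      case False
      hence "v @ [i] \<notin> gw_tree X" for X using gw_tree_subset_vertices snoc_in_gw_tree_iff by blast
      thus ?thesis by simp
    qed
  qed simp
  thus "{X \<in> space (offspring_space p). v \<in> gw_tree X} \<in> sets (offspring_space p)" by (simp add: pred_def)
qed (use gw_tree_subset_vertices in auto)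

definition child_count :: "vertex set \<Rightarrow> vertex \<Rightarrow> nat" where
  "child_count A v = card {i. v @ [i] \<in> A}"

lemma finite_children: "finite A \<Longrightarrow> finite {i. v @ [i] \<in> A}"
  using finite_vimageI[of A "\<lambda>i. v @ [i]"] by (simp add: inj_on_def vimage_def)

lemma children_eq:
  assumes A: "plane_closed A" "finite A"
  shows "{i. v @ [i] \<in> A} = {1..child_count A v}"
proof -
  let ?K = "{i. v @ [i] \<in> A}"
  have fin: "finite ?K" by (rule finite_children[OF A(2)])
  show ?thesis
  proof (cases "?K = {}")
    case True thus ?thesis by (simp add: child_count_def)
  next
    case False
    define m where "m = Max ?K"
    have m: "v @ [m] \<in> A" using Max_in[OF fin False] by (simp add: m_def)
    have "?K = {1..m}"
    proof (intro equalityI subsetI)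
      fix i assume i: "i \<in> ?K"
      hence "v @ [i] \<in> vertices" using A(1) by (auto simp: plane_closed_def)
      hence "1 \<le> i" by (simp add: vertices_def)
      thus "i \<in> {1..m}" using i fin by (simp add: m_def)
    next
      fix i assume i: "i \<in> {1..m}"
      then obtain j where j: "i = Suc j" by (cases i) auto
      have "v @ [Suc (j + (m - i))] \<in> A" using m i j by simp
      thus "i \<in> ?K" using plane_closed_earlier_child[OF A(1)] j by simp
    qed
    thus ?thesis by (simp add: child_count_def)
  qed
qed

text \<open>Containing \<open>A\<close>, and being equal to \<open>A\<close>, are conditions on the offspring numbers of the vertices of
  \<open>A\<close> only; hence both probabilities are finite products.\<close>
lemma subset_gw_tree_iff:
  assumes A: "plane_closed A" "finite A"
  shows "A \<subseteq> gw_tree X \<longleftrightarrow> (\<forall>v\<in>A. enat (child_count A v) \<le> X v)"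
proof
  assume sub: "A \<subseteq> gw_tree X"
  show "\<forall>v\<in>A. enat (child_count A v) \<le> X v"
  proof
    fix v assume "v \<in> A"
    show "enat (child_count A v) \<le> X v"
    proof (cases "child_count A v = 0")
      case False
      hence "child_count A v \<in> {i. v @ [i] \<in> A}" unfolding children_eq[OF A] by simp
      thus ?thesis using sub snoc_in_gw_tree_iff by blast
    qed (simp flip: zero_enat_def)
  qed
next
  assume X: "\<forall>v\<in>A. enat (child_count A v) \<le> X v"
  have "v \<in> A \<Longrightarrow> v \<in> gw_tree X" for v
  proof (induction v rule: rev_induct)
    case (snoc i v)
    have v: "v \<in> A" by (rule plane_closed_take[OF A(1) snoc.prems])
    have "i \<in> {i. v @ [i] \<in> A}" using snoc.prems by simp
    hence i: "1 \<le> i" "i \<le> child_count A v" unfolding children_eq[OF A] by auto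
    have "enat i \<le> enat (child_count A v)" using i by simp
    also have "\<dots> \<le> X v" using X v by blast
    finally show ?case using snoc.IH[OF v] i by (simp add: snoc_in_gw_tree_iff)
  qed simp
  thus "A \<subseteq> gw_tree X" by blast
qed

lemma gw_tree_eq_iff:
  assumes A: "plane_closed A" "finite A"
  shows "gw_tree X = A \<longleftrightarrow> (\<forall>v\<in>A. X v = enat (child_count A v))"
proof
  assume eq: "gw_tree X = A"
  show "\<forall>v\<in>A. X v = enat (child_count A v)"
  proof (intro ballI antisym)
    fix v assume v: "v \<in> A"
    show "enat (child_count A v) \<le> X v" using subset_gw_tree_iff[OF A, of X] eq v by blast
    show "X v \<le> enat (child_count A v)"
    proof (rule ccontr)
      assume "\<not> X v \<le> enat (child_count A v)"
      hence "enat (Suc (child_count A v)) \<le> X v" by (simp add: Suc_ile_eq)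
      hence "v @ [Suc (child_count A v)] \<in> A" using v eq snoc_in_gw_tree_iff[of v _ X] by auto
      hence "Suc (child_count A v) \<in> {1..child_count A v}" unfolding children_eq[OF A, symmetric] by simp
      thus False by simp
    qed
  qed
next
  assume X: "\<forall>v\<in>A. X v = enat (child_count A v)"
  have "v \<in> gw_tree X \<Longrightarrow> v \<in> A" for v
  proof (induction v rule: rev_induct)
    case (snoc i v)
    hence v: "v \<in> A" and i: "1 \<le> i" "enat i \<le> X v" by (auto simp: snoc_in_gw_tree_iff)
    hence "i \<in> {1..child_count A v}" using X by simp
    thus ?case unfolding children_eq[OF A, symmetric] by simp
  qed (use A in \<open>simp add: plane_closed_def\<close>)
  moreover have "A \<subseteq> gw_tree X" using X subset_gw_tree_iff[OF A] by simp
  ultimately show "gw_tree X = A" by blast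
qed

lemma sum_child_count:
  assumes A: "plane_closed A" "finite A"
  shows "(\<Sum>v\<in>A. child_count A v) = card A - 1"
proof -
  have "(\<Sum>v\<in>A. child_count A v) = card (SIGMA v:A. {i. v @ [i] \<in> A})"
    unfolding child_count_def using A(2) by (subst card_SigmaI) (auto intro: finite_children)
  also have "\<dots> = card ((\<lambda>(v, i). v @ [i]) ` (SIGMA v:A. {i. v @ [i] \<in> A}))"
    by (rule card_image[symmetric]) (auto simp: inj_on_def)
  also have "(\<lambda>(v, i). v @ [i]) ` (SIGMA v:A. {i. v @ [i] \<in> A}) = A - {[]}"
  proof (intro equalityI subsetI)
    fix w assume w: "w \<in> A - {[]}"
    then obtain v i where vi: "w = v @ [i]" by (cases w rule: rev_cases) auto
    hence "v \<in> A" using w plane_closed_take[OF A(1), of v "[i]"] by simp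
    thus "w \<in> (\<lambda>(v, i). v @ [i]) ` (SIGMA v:A. {i. v @ [i] \<in> A})"
      using w vi by (intro image_eqI[of _ _ "(v, i)"]) auto
  qed auto
  also have "card (A - {[]}) = card A - 1"
    using A by (simp add: plane_closed_def card_Diff_singleton)
  finally show ?thesis .
qed

lemma emeasure_offspring_eq:
  assumes "0 \<le> p" "p \<le> 1"
  shows "emeasure (measure_pmf (offspring_pmf p)) {enat d} = ennreal (p ^ d * (1 - p))"
proof (cases "p = 1")
  case True thus ?thesis by (simp add: offspring_pmf_def emeasure_pmf_single)
next
  case False
  have "pmf (map_pmf enat (geometric_pmf (1 - p))) (enat d) = pmf (geometric_pmf (1 - p)) d"
    by (rule pmf_map_inj') (simp add: inj_on_def)
  thus ?thesis using False assms by (simp add: offspring_pmf_def emeasure_pmf_single)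
qed

lemma emeasure_offspring_ge:
  assumes "0 \<le> p" "p \<le> 1"
  shows "emeasure (measure_pmf (offspring_pmf p)) {x. enat d \<le> x} = ennreal (p ^ d)"
proof (cases "p = 1")
  case True thus ?thesis by (simp add: offspring_pmf_def)
next
  case False
  have "measure (measure_pmf (offspring_pmf p)) {x. enat d \<le> x} = measure (measure_pmf (geometric_pmf (1 - p))) {d..}"
    using False by (simp add: offspring_pmf_def vimage_def atLeast_def)
  also have "{d..} = space (measure_pmf (geometric_pmf (1 - p))) - {..<d}" by auto
  also have "measure (measure_pmf (geometric_pmf (1 - p))) \<dots> = 1 - measure (measure_pmf (geometric_pmf (1 - p))) {..<d}"
    by (rule measure_pmf.prob_compl) simp
  also have "measure (measure_pmf (geometric_pmf (1 - p))) {..<d} = (\<Sum>n<d. p ^ n * (1 - p))"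
    using False assms by (simp add: measure_measure_pmf_finite)
  also have "\<dots> = 1 - p ^ d"
    using one_diff_power_eq[of p d] by (simp add: sum_distrib_left mult.commute)
  finally show ?thesis by (simp add: measure_pmf.emeasure_eq_measure)
qed

lemma emeasure_offspring_space:
  assumes "finite A" "A \<subseteq> vertices"
  shows "emeasure (offspring_space p) {X \<in> space (offspring_space p). \<forall>v\<in>A. X v \<in> Y v}
    = (\<Prod>v\<in>A. emeasure (measure_pmf (offspring_pmf p)) (Y v))"
proof -
  interpret product_prob_space "\<lambda>_ :: vertex. measure_pmf (offspring_pmf p)" vertices ..
  show ?thesis using assms by (intro emeasure_PiM_Collect) auto
qed

lemma sets_gw_law [simp]: "sets (gw_law p) = sets tree_space"
  and space_gw_law [simp]: "space (gw_law p) = Pow vertices"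
  by (simp_all add: gw_law_def)

lemma prob_space_gw_law: "prob_space (gw_law p)"
proof -
  interpret product_prob_space "\<lambda>_ :: vertex. measure_pmf (offspring_pmf p)" vertices ..
  show ?thesis unfolding gw_law_def by (rule prob_space_distr[OF measurable_gw_tree])
qed

lemma sets_singleton_tree: "A \<subseteq> vertices \<Longrightarrow> {A} \<in> sets tree_space"
proof -
  assume "A \<subseteq> vertices"
  hence "{A} = {T \<in> space tree_space. T = A}" by auto
  thus ?thesis using measurable_tree_eq[OF measurable_ident[of tree_space], of A] by (simp add: pred_def)
qed

lemma emeasure_gw_law_superset:
  assumes p: "0 \<le> p" "p \<le> 1"
  shows "emeasure (gw_law p) {T \<in> space tree_space. plane t \<subseteq> T} = ennreal (p ^ (leaves t - 1))"
proof -
  let ?d = "child_count (plane t)"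
  have "emeasure (gw_law p) {T \<in> space tree_space. plane t \<subseteq> T}
      = emeasure (offspring_space p) (gw_tree -` {T \<in> space tree_space. plane t \<subseteq> T} \<inter> space (offspring_space p))"
    unfolding gw_law_def by (rule emeasure_distr[OF measurable_gw_tree sets_superset])
  also have "gw_tree -` {T \<in> space tree_space. plane t \<subseteq> T} \<inter> space (offspring_space p)
      = {X \<in> space (offspring_space p). \<forall>v\<in>plane t. X v \<in> {x. enat (?d v) \<le> x}}"
    using gw_tree_subset_vertices subset_gw_tree_iff[OF plane_closed_plane finite_plane, of t] by auto
  also have "emeasure (offspring_space p) \<dots> = (\<Prod>v\<in>plane t. ennreal (p ^ ?d v))"
    by (subst emeasure_offspring_space) (simp_all add: plane_subset_vertices emeasure_offspring_ge p)
  also have "\<dots> = ennreal (p ^ (\<Sum>v\<in>plane t. ?d v))"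
    using p by (simp add: prod_ennreal power_sum)
  also have "(\<Sum>v\<in>plane t. ?d v) = leaves t - 1"
    by (simp add: sum_child_count plane_closed_plane card_plane)
  finally show ?thesis .
qed

lemma emeasure_gw_law_singleton:
  assumes p: "0 \<le> p" "p \<le> 1"
  shows "emeasure (gw_law p) {plane t} = ennreal (p ^ (leaves t - 1) * (1 - p) ^ leaves t)"
proof -
  let ?d = "child_count (plane t)"
  have "emeasure (gw_law p) {plane t} = emeasure (offspring_space p) (gw_tree -` {plane t} \<inter> space (offspring_space p))"
    unfolding gw_law_def by (rule emeasure_distr[OF measurable_gw_tree sets_singleton_tree[OF plane_subset_vertices]])
  also have "gw_tree -` {plane t} \<inter> space (offspring_space p)
      = {X \<in> space (offspring_space p). \<forall>v\<in>plane t. X v \<in> {enat (?d v)}}"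
    using gw_tree_eq_iff[OF plane_closed_plane finite_plane, of _ t] by auto
  also have "emeasure (offspring_space p) \<dots> = (\<Prod>v\<in>plane t. ennreal (p ^ ?d v * (1 - p)))"
    by (subst emeasure_offspring_space) (simp_all add: plane_subset_vertices emeasure_offspring_eq p)
  also have "\<dots> = ennreal (p ^ (\<Sum>v\<in>plane t. ?d v) * (1 - p) ^ leaves t)"
    using p by (subst prod_ennreal) (simp_all add: power_sum prod.distrib card_plane)
  also have "(\<Sum>v\<in>plane t. ?d v) = leaves t - 1"
    by (simp add: sum_child_count plane_closed_plane card_plane)
  finally show ?thesis .
qed

lemma AE_gw_law_plane_closed: "AE T in gw_law p. plane_closed T"
  unfolding gw_law_def by (rule AE_plane_closed_distr[OF measurable_gw_tree plane_closed_gw_tree])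

lemma finite_plane_closed_iff: "plane_closed T \<and> finite T \<longleftrightarrow> (\<exists>t. T = plane t)"
proof
  assume "plane_closed T \<and> finite T"
  hence "T \<in> plane ` {t. leaves t = card T}"
    unfolding finite_rooted_ordered_trees_eq[symmetric] rooted_ordered_trees_eq by simp
  thus "\<exists>t. T = plane t" by blast
qed (auto simp: plane_closed_plane)

lemma sets_finite_tree: "{T \<in> space tree_space. finite T} \<in> sets tree_space"
proof -
  have "{T \<in> space tree_space. finite T} = (\<Union>A\<in>{A. finite A \<and> A \<subseteq> vertices}. {A})" by auto
  moreover have "countable {A :: vertex set. finite A \<and> A \<subseteq> vertices}"
    by (rule countable_subset[OF _ countable_Collect_finite]) auto
  ultimately show ?thesis by (simp only:) (intro sets.countable_UN'', auto intro: sets_singleton_tree)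
qed

text \<open>A given tree with \<open>n\<close> vertices has probability \<open>p ^ (n - 1) * (1 - p) ^ n\<close>, whatever its shape.
  Summing over the finite trees that contain \<open>plane t\<close> gives the generating function, up to the
  factor \<open>1 / p\<close>.\<close>
lemma emeasure_gw_law_finite_superset:
  assumes p: "1/2 < p" "p \<le> 1"
  shows "emeasure (gw_law p) {T \<in> space tree_space. plane t \<subseteq> T \<and> finite T}
    = ennreal (extension_gf (1 - p) t / p)"
proof -
  let ?S = "\<lambda>n. {t'. leaves t' = n \<and> embeds t t'}"
  have sing: "{plane t'} \<in> sets (gw_law p)" for t'
    using sets_singleton_tree[OF plane_subset_vertices] by simp
  have E: "plane ` ?S n \<in> sets (gw_law p)" for n
  proof -
    have "(\<Union>t'\<in>?S n. {plane t'}) \<in> sets (gw_law p)"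
      using sing by (intro sets.finite_UN finite_extensions) auto
    also have "(\<Union>t'\<in>?S n. {plane t'}) = plane ` ?S n" by blast
    finally show ?thesis .
  qed
  have "{T \<in> space tree_space. plane t \<subseteq> T \<and> finite T} \<in> sets tree_space"
    using sets.Int[OF sets_superset[of "plane t"] sets_finite_tree] by (simp add: Collect_conj_eq Int_ac)
  hence "emeasure (gw_law p) {T \<in> space tree_space. plane t \<subseteq> T \<and> finite T} = emeasure (gw_law p) (\<Union>n. plane ` ?S n)"
  proof (intro emeasure_eq_AE)
    show "AE T in gw_law p. (T \<in> {T \<in> space tree_space. plane t \<subseteq> T \<and> finite T}) = (T \<in> (\<Union>n. plane ` ?S n))"
      using AE_gw_law_plane_closed
    proof eventually_elim
      fix T assume T: "plane_closed T"
      have "plane t \<subseteq> T \<and> finite T \<longleftrightarrow> (\<exists>t'. embeds t t' \<and> T = plane t')"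
        using T finite_plane_closed_iff[of T] plane_subset_iff_embeds[of t] by blast
      moreover have "T \<in> space tree_space" using T by (simp add: plane_closed_def)
      ultimately show "(T \<in> {T \<in> space tree_space. plane t \<subseteq> T \<and> finite T}) = (T \<in> (\<Union>n. plane ` ?S n))"
        by blast
    qed
  qed (use E in auto)
  also have "\<dots> = (\<Sum>n. emeasure (gw_law p) (plane ` ?S n))"
  proof (rule suminf_emeasure[symmetric])
    show "disjoint_family (\<lambda>n. plane ` ?S n)"
      unfolding disjoint_family_on_def
    proof (intro ballI impI equals0I)
      fix m n :: nat and T assume "m \<noteq> n" "T \<in> plane ` ?S m \<inter> plane ` ?S n"
      hence "card T = m" "card T = n" by (auto simp: card_plane)
      thus False using \<open>m \<noteq> n\<close> by simp
    qed
  qed (use E in auto)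
  also have "\<dots> = (\<Sum>n. ennreal (real (extensions t n) * ((1 - p) * (1 - (1 - p))) ^ n / p))"
  proof (rule suminf_cong)
    fix n
    have "emeasure (gw_law p) (plane ` ?S n) = (\<Sum>T\<in>plane ` ?S n. emeasure (gw_law p) {T})"
      using finite_extensions[of n t] sing by (intro emeasure_eq_sum_singleton) auto
    also have "\<dots> = (\<Sum>t'\<in>?S n. emeasure (gw_law p) {plane t'})"
      by (simp only: sum.reindex[OF inj_on_subset[OF inj_plane subset_UNIV]] comp_def)
    also have "\<dots> = (\<Sum>t'\<in>?S n. ennreal (p ^ (n - 1) * (1 - p) ^ n))"
    proof (rule sum.cong[OF refl])
      fix t' assume "t' \<in> ?S n"
      thus "emeasure (gw_law p) {plane t'} = ennreal (p ^ (n - 1) * (1 - p) ^ n)"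
        using p by (subst emeasure_gw_law_singleton) auto
    qed
    also have "\<dots> = ennreal (real (extensions t n) * (p ^ (n - 1) * (1 - p) ^ n))"
    proof -
      have "ennreal (real m * c) = of_nat m * ennreal c" if "0 \<le> c" for m c
        using that by (simp add: ennreal_mult ennreal_of_nat_eq_real_of_nat)
      moreover have "0 \<le> p ^ (n - 1) * (1 - p) ^ n" using p by simp
      ultimately show ?thesis by (simp only: sum_constant extensions_def)
    qed
    also have "real (extensions t n) * (p ^ (n - 1) * (1 - p) ^ n)
        = real (extensions t n) * ((1 - p) * (1 - (1 - p))) ^ n / p"
      using p by (cases n) (simp_all add: power_mult_distrib)
    finally show "emeasure (gw_law p) (plane ` ?S n)
      = ennreal (real (extensions t n) * ((1 - p) * (1 - (1 - p))) ^ n / p)" .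
  qed
  also have "\<dots> = ennreal (extension_gf (1 - p) t / p)"
  proof -
    have "(\<lambda>n. real (extensions t n) * ((1 - p) * (1 - (1 - p))) ^ n / p) sums (extension_gf (1 - p) t / p)"
      using p by (intro sums_divide extension_gf_sums) auto
    hence s: "summable (\<lambda>n. real (extensions t n) * ((1 - p) * (1 - (1 - p))) ^ n / p)"
      "(\<Sum>n. real (extensions t n) * ((1 - p) * (1 - (1 - p))) ^ n / p) = extension_gf (1 - p) t / p"
      by (simp_all only: sums_iff)
    have "0 \<le> real (extensions t n) * ((1 - p) * (1 - (1 - p))) ^ n / p" for n
      using p by (intro divide_nonneg_nonneg mult_nonneg_nonneg zero_le_power) auto
    from suminf_ennreal2[OF this s(1)] show ?thesis by (simp only: s(2))
  qed
  finally show ?thesis .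
qed

lemma emeasure_gw_law_infinite_superset:
  assumes p: "1/2 < p" "p \<le> 1"
  shows "emeasure (gw_law p) {T \<in> space tree_space. plane t \<subseteq> T \<and> infinite T}
    = ennreal ((p ^ leaves t - extension_gf (1 - p) t) / p)"
proof -
  interpret prob_space "gw_law p" by (rule prob_space_gw_law)
  let ?A = "{T \<in> space tree_space. plane t \<subseteq> T}"
  let ?B = "{T \<in> space tree_space. plane t \<subseteq> T \<and> finite T}"
  have B: "?B \<in> sets (gw_law p)"
    using sets.Int[OF sets_superset[of "plane t"] sets_finite_tree] by (simp add: Collect_conj_eq Int_ac)
  have "{T \<in> space tree_space. plane t \<subseteq> T \<and> infinite T} = ?A - ?B" by auto
  also have "emeasure (gw_law p) (?A - ?B) = emeasure (gw_law p) ?A - emeasure (gw_law p) ?B"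
    using B sets_superset by (intro emeasure_Diff) auto
  also have "\<dots> = ennreal (p ^ (leaves t - 1) - extension_gf (1 - p) t / p)"
  proof -
    have "emeasure (gw_law p) ?A = ennreal (p ^ (leaves t - 1))"
      using p by (intro emeasure_gw_law_superset) auto
    moreover have "0 \<le> extension_gf (1 - p) t / p" using p extension_gf_nonneg[of "1 - p" t] by simp
    ultimately show ?thesis
      by (simp only: emeasure_gw_law_finite_superset[OF p] ennreal_minus)
  qed
  also have "p ^ (leaves t - 1) - extension_gf (1 - p) t / p = (p ^ leaves t - extension_gf (1 - p) t) / p"
  proof -
    have "p ^ leaves t = p * p ^ (leaves t - 1)" using leaves_pos[of t] by (cases "leaves t") auto
    thus ?thesis using p by (simp add: field_simps)
  qed
  finally show ?thesis .
qed

text \<open>Both laws give the event \<open>plane t \<subseteq> T\<close> the probability of \<open>cover_prob_infinity\<close>: for the conditioned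
  Galton-Watson tree it is the quotient of \<open>(p ^ leaves t - extension_gf (1 - p) t) / p\<close> by the
  survival probability \<open>(2 * p - 1) / p\<close>.\<close>
lemma infinite_tree_law_eq_grown:
  assumes p: "1/2 < p" "p \<le> 1"
  shows "infinite_tree_law p = distr randomness tree_space (grown_tree (1 - p) \<infinity>)"
proof -
  let ?I = "{T \<in> space (gw_law p). infinite T}"
  let ?N = "distr randomness tree_space (grown_tree (1 - p) \<infinity>)"
  interpret gw: prob_space "gw_law p" by (rule prob_space_gw_law)
  have law: "infinite_tree_law p = uniform_measure (gw_law p) ?I" using p by (simp add: infinite_tree_law_def)
  have I: "?I \<in> sets (gw_law p)"
  proof -
    have "?I = space tree_space - {T \<in> space tree_space. finite T}" by auto
    thus ?thesis using sets.compl_sets[OF sets_finite_tree] by (simp only: sets_gw_law)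
  qed
  have emI: "emeasure (gw_law p) ?I = ennreal ((2 * p - 1) / p)"
  proof -

    have "emeasure (gw_law p) ?I = emeasure (gw_law p) {T \<in> space tree_space. plane Stump \<subseteq> T \<and> infinite T}"
    proof (rule emeasure_eq_AE[OF _ I])
      show "AE T in gw_law p. (T \<in> ?I) = (T \<in> {T \<in> space tree_space. plane Stump \<subseteq> T \<and> infinite T})"
        using AE_gw_law_plane_closed by eventually_elim (simp add: plane_closed_def)
      show "{T \<in> space tree_space. plane Stump \<subseteq> T \<and> infinite T} \<in> sets (gw_law p)"
      proof -
        have "{T \<in> space tree_space. plane Stump \<subseteq> T \<and> infinite T}
            = {T \<in> space tree_space. plane Stump \<subseteq> T} - {T \<in> space tree_space. finite T}" by auto
        thus ?thesis using sets.Diff[OF sets_superset sets_finite_tree] by (simp only: sets_gw_law)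
      qed
    qed
    also have "\<dots> = ennreal ((2 * p - 1) / p)"
      unfolding emeasure_gw_law_infinite_superset[OF p] using p
      by (simp add: extension_gf_Stump)
    finally show ?thesis .
  qed
  show ?thesis
  proof (rule plane_tree_measure_eqI)
    have "prob_space (infinite_tree_law p)" unfolding law
      using emI p by (intro prob_space_uniform_measure) auto
    thus "finite_measure (infinite_tree_law p)" by (rule prob_space.finite_measure)
    show "sets (infinite_tree_law p) = sets tree_space" by (simp add: law)
    have "AE T in gw_law p. T \<in> ?I \<longrightarrow> plane_closed T"
      using AE_gw_law_plane_closed by eventually_elim simp
    thus "AE T in infinite_tree_law p. plane_closed T" unfolding law
      by (rule AE_uniform_measureI[OF I])
    show "sets ?N = sets tree_space" by simp
    show "AE T in ?N. plane_closed T"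
      by (intro AE_plane_closed_distr measurable_grown_tree plane_closed_grown_tree) auto
    fix t
    have "emeasure (infinite_tree_law p) {T \<in> space tree_space. plane t \<subseteq> T}
        = emeasure (gw_law p) (?I \<inter> {T \<in> space tree_space. plane t \<subseteq> T}) / emeasure (gw_law p) ?I"
      unfolding law using I sets_superset by (intro emeasure_uniform_measure) auto
    also have "?I \<inter> {T \<in> space tree_space. plane t \<subseteq> T} = {T \<in> space tree_space. plane t \<subseteq> T \<and> infinite T}"
      by auto
    also have "emeasure (gw_law p) \<dots> / emeasure (gw_law p) ?I
        = ennreal ((p ^ leaves t - extension_gf (1 - p) t) / p / ((2 * p - 1) / p))"
      unfolding emI emeasure_gw_law_infinite_superset[OF p]
      using p extension_gf_le[of "1 - p" t] by (intro divide_ennreal) auto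
    also have "(p ^ leaves t - extension_gf (1 - p) t) / p / ((2 * p - 1) / p)
        = ((1 - (1 - p)) ^ leaves t - extension_gf (1 - p) t) / (1 - 2 * (1 - p))"
      using p by simp
    also have "ennreal \<dots> = cover_prob (1 - p) \<infinity> t"
      using p by (subst cover_prob_infinity) auto
    also have "\<dots> = emeasure ?N {T \<in> space tree_space. plane t \<subseteq> T}"
      by (rule emeasure_distr_grown_tree[symmetric])
    finally show "emeasure (infinite_tree_law p) {T \<in> space tree_space. plane t \<subseteq> T}
      = emeasure ?N {T \<in> space tree_space. plane t \<subseteq> T}" .
  qed
qed

section \<open>Uniform trees and the critical law\<close>

lemma uniform_tree_law_eq_grown:
  assumes q: "0 \<le> q" "q \<le> 1/2" and k: "1 \<le> k"
  shows "uniform_tree_law k = distr randomness tree_space (grown_tree q (enat k))"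
proof -
  let ?S = "plane ` {t. leaves t = k}"
  let ?U = "uniform_count_measure ?S"
  have law: "uniform_tree_law k = distr ?U tree_space (\<lambda>T. T)"
    by (simp add: uniform_tree_law_def finite_rooted_ordered_trees_eq)
  have fin: "finite ?S" using finite_leaves_eq by simp
  have card: "card ?S = tree_count k"
    by (simp add: card_image[OF inj_on_subset[OF inj_plane]] extensions_def)
  have ne: "?S \<noteq> {}" using card tree_count_pos[OF k] by force
  have meas: "(\<lambda>T. T) \<in> ?U \<rightarrow>\<^sub>M tree_space"
    using plane_subset_vertices
    by (intro measurable_into_tree_space) (auto simp: space_uniform_count_measure sets_uniform_count_measure)
  show ?thesis
  proof (rule plane_tree_measure_eqI)
    have "prob_space (uniform_tree_law k)" unfolding law
      by (rule prob_space.prob_space_distr[OF prob_space_uniform_count_measure[OF fin ne] meas])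
    thus "finite_measure (uniform_tree_law k)" by (rule prob_space.finite_measure)
    show "AE T in uniform_tree_law k. plane_closed T" unfolding law
      by (rule AE_plane_closed_distr[OF meas]) (auto simp: space_uniform_count_measure plane_closed_plane)
    show "AE T in distr randomness tree_space (grown_tree q (enat k)). plane_closed T"
      using k by (intro AE_plane_closed_distr measurable_grown_tree plane_closed_grown_tree) (auto simp: zero_enat_def)
    fix t
    have "emeasure (uniform_tree_law k) {T \<in> space tree_space. plane t \<subseteq> T}
        = emeasure ?U ((\<lambda>T. T) -` {T \<in> space tree_space. plane t \<subseteq> T} \<inter> space ?U)"
      unfolding law by (rule emeasure_distr[OF meas sets_superset])
    also have "(\<lambda>T. T) -` {T \<in> space tree_space. plane t \<subseteq> T} \<inter> space ?U = plane ` {t'. leaves t' = k \<and> embeds t t'}"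
      unfolding space_uniform_count_measure space_tree_space
      using plane_subset_vertices plane_subset_iff_embeds[of t] by blast
    also have "emeasure ?U \<dots> = ennreal (real (card (plane ` {t'. leaves t' = k \<and> embeds t t'})) / real (card ?S))"
      by (rule emeasure_uniform_count_measure[OF fin]) auto
    also have "card (plane ` {t'. leaves t' = k \<and> embeds t t'}) = extensions t k"
      by (simp add: card_image[OF inj_on_subset[OF inj_plane]] extensions_def)
    also have "ennreal (real (extensions t k) / real (card ?S)) = cover_prob q (enat k) t"
      unfolding card by (rule cover_prob_enat[OF q k, symmetric])
    finally show "emeasure (uniform_tree_law k) {T \<in> space tree_space. plane t \<subseteq> T}
      = emeasure (distr randomness tree_space (grown_tree q (enat k))) {T \<in> space tree_space. plane t \<subseteq> T}"
      unfolding emeasure_distr_grown_tree .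
  qed (simp_all add: law)
qed

lemma has_law_distr:
  assumes "f \<in> R \<rightarrow>\<^sub>M P" "g \<in> P \<rightarrow>\<^sub>M tree_space" "distr R tree_space (\<lambda>\<omega>. g (f \<omega>)) = N"
  shows "has_law (distr R P f) g N"
  using assms by (simp add: has_law_def distr_distr comp_def)

lemma all_ge_1_iff: "(\<forall>k\<ge>1::nat. P k) \<longleftrightarrow> (\<forall>k. P (Suc k))"
proof (intro iffI allI impI)
  fix k :: nat assume "\<forall>k. P (Suc k)" "1 \<le> k" thus "P k" by (cases k) auto
qed simp

lemma UN_ge_1_eq: "(\<Union>k\<in>{1::nat..}. S k) = (\<Union>k. S (Suc k))"
proof -
  have "{1::nat..} = range Suc"
  proof (intro equalityI subsetI)
    fix k :: nat assume "k \<in> {1..}" thus "k \<in> range Suc" by (cases k) auto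
  qed auto
  thus ?thesis by (simp only: image_image)
qed

lemma finite_subset_increasing_Union:
  assumes "finite A" "\<And>k::nat. S k \<subseteq> S (Suc k)" "A \<subseteq> (\<Union>k. S k)"
  shows "\<exists>k. A \<subseteq> S k"
proof -
  have mono: "S k \<subseteq> S l" if "k \<le> l" for k l
    using that by (rule lift_Suc_mono_le[of S, OF assms(2)])
  have "\<forall>a\<in>A. \<exists>k. a \<in> S k" using assms(3) by blast
  then obtain f where f: "\<forall>a\<in>A. a \<in> S (f a)" by (rule bchoice[THEN exE])
  have "a \<in> S (Max (f ` A))" if a: "a \<in> A" for a
  proof -
    have "f a \<le> Max (f ` A)" using a assms(1) by simp
    thus ?thesis using mono f a by blast
  qed
  thus ?thesis by blast
qed

text \<open>A finite set is contained in an increasing union exactly if some term contains it. So the law of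
  the union of a coupling is determined by the uniform laws alone.\<close>
lemma union_law_superset:
  fixes M :: "'a measure"
  assumes C: "increasing_uniform_coupling M T" and N: "has_law M (\<lambda>\<omega>. \<Union>k\<in>{1..}. T k \<omega>) N"
    and A: "finite A"
  shows "emeasure N {S \<in> space tree_space. A \<subseteq> S}
    = (SUP k. emeasure (uniform_tree_law (Suc k)) {S \<in> space tree_space. A \<subseteq> S})"
proof -
  interpret prob_space M using C by (simp add: increasing_uniform_coupling_def)
  let ?B = "{S \<in> space tree_space. A \<subseteq> S}"
  have T: "T (Suc k) \<in> M \<rightarrow>\<^sub>M tree_space" "distr M tree_space (T (Suc k)) = uniform_tree_law (Suc k)" for k
    using C unfolding increasing_uniform_coupling_def has_law_def all_ge_1_iff by blast+
  let ?G = "{\<omega> \<in> space M. \<forall>k\<ge>1. T k \<omega> \<subseteq> T (Suc k) \<omega>}"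
  \<comment> \<open>The trees increase only almost surely; on the event \<open>?G\<close> they always do.\<close>
  let ?E = "\<lambda>k. {\<omega> \<in> ?G. A \<subseteq> T (Suc k) \<omega>}"
  have Geq: "?G = {\<omega> \<in> space M. \<forall>k. T (Suc k) \<omega> \<subseteq> T (Suc (Suc k)) \<omega>}"
    by (simp only: all_ge_1_iff)
  have G: "?G \<in> events" unfolding Geq
    using measurable_tree_subset[OF T(1) T(1)] unfolding pred_def by (rule sets.sets_Collect_countable_All)
  have "prob ?G = 1" using C unfolding increasing_uniform_coupling_def by blast
  hence AEG: "AE \<omega> in M. \<omega> \<in> ?G" using prob_eq_1[OF G] by blast
  have AT: "{\<omega> \<in> space M. A \<subseteq> T (Suc k) \<omega>} \<in> events" for k
    using measurable_subset_tree_space[OF T(1), of A k] unfolding pred_def .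
  have E: "?E k \<in> events" for k
  proof -
    have "?E k = ?G \<inter> {\<omega> \<in> space M. A \<subseteq> T (Suc k) \<omega>}" by auto
    thus ?thesis using sets.Int[OF G AT] by (simp only:)
  qed
  have Um: "(\<lambda>\<omega>. \<Union>k\<in>{1..}. T k \<omega>) \<in> M \<rightarrow>\<^sub>M tree_space" and NU: "distr M tree_space (\<lambda>\<omega>. \<Union>k\<in>{1..}. T k \<omega>) = N"
    using N unfolding has_law_def by blast+
  have Ueq: "(\<Union>k\<in>{1..}. T k \<omega>) = (\<Union>k. T (Suc k) \<omega>)" for \<omega>
    by (rule UN_ge_1_eq)
  have "emeasure N ?B = emeasure M ((\<lambda>\<omega>. \<Union>k\<in>{1..}. T k \<omega>) -` ?B \<inter> space M)"
    unfolding NU[symmetric] by (rule emeasure_distr[OF Um sets_superset])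
  also have "\<dots> = emeasure M (\<Union>k. ?E k)"
  proof (rule emeasure_eq_AE)
    show "AE \<omega> in M. (\<omega> \<in> (\<lambda>\<omega>. \<Union>k\<in>{1..}. T k \<omega>) -` ?B \<inter> space M) = (\<omega> \<in> (\<Union>k. ?E k))"
      using AEG
    proof eventually_elim
      fix \<omega> assume w: "\<omega> \<in> ?G"
      have inc: "T (Suc k) \<omega> \<subseteq> T (Suc (Suc k)) \<omega>" for k using w unfolding Geq by blast
      have "A \<subseteq> (\<Union>k. T (Suc k) \<omega>) \<longleftrightarrow> (\<exists>k. A \<subseteq> T (Suc k) \<omega>)"
        using finite_subset_increasing_Union[OF A, of "\<lambda>k. T (Suc k) \<omega>", OF inc] by blast
      moreover have "(\<Union>k\<in>{1..}. T k \<omega>) \<in> space tree_space"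
        using measurable_space[OF Um] w by blast
      ultimately show "(\<omega> \<in> (\<lambda>\<omega>. \<Union>k\<in>{1..}. T k \<omega>) -` ?B \<inter> space M) = (\<omega> \<in> (\<Union>k. ?E k))"
        using w unfolding Ueq vimage_eq Int_iff mem_Collect_eq UN_iff by blast
    qed
    show "(\<lambda>\<omega>. \<Union>k\<in>{1..}. T k \<omega>) -` ?B \<inter> space M \<in> events"
      by (rule measurable_sets[OF Um sets_superset])
    show "(\<Union>k. ?E k) \<in> events" using E by blast
  qed
  also have "\<dots> = (SUP k. emeasure M (?E k))"
  proof (rule SUP_emeasure_incseq[symmetric])
    show "incseq ?E"
    proof (rule incseq_SucI, rule subsetI)
      fix k \<omega> assume w: "\<omega> \<in> ?E k"
      hence "T (Suc k) \<omega> \<subseteq> T (Suc (Suc k)) \<omega>" unfolding Geq by blast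
      thus "\<omega> \<in> ?E (Suc k)" using w by blast
    qed
    show "range ?E \<subseteq> events" using E by (rule image_subsetI)
  qed
  also have "(\<lambda>k. emeasure M (?E k)) = (\<lambda>k. emeasure (uniform_tree_law (Suc k)) ?B)"
  proof
    fix k
    have "emeasure M (?E k) = emeasure M {\<omega> \<in> space M. A \<subseteq> T (Suc k) \<omega>}"
    proof (rule emeasure_eq_AE[OF _ E AT])
      show "AE \<omega> in M. (\<omega> \<in> ?E k) = (\<omega> \<in> {\<omega> \<in> space M. A \<subseteq> T (Suc k) \<omega>})"
        using AEG by eventually_elim blast
    qed
    also have "{\<omega> \<in> space M. A \<subseteq> T (Suc k) \<omega>} = T (Suc k) -` ?B \<inter> space M"
      using measurable_space[OF T(1)] by auto
    also have "emeasure M \<dots> = emeasure (uniform_tree_law (Suc k)) ?B"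
      unfolding T(2)[symmetric] by (rule emeasure_distr[OF T(1) sets_superset, symmetric])
    finally show "emeasure M (?E k) = emeasure (uniform_tree_law (Suc k)) ?B" .
  qed
  finally show ?thesis .
qed

text \<open>The grown trees of the finite types \<open>1, 2, \<dots>\<close> form an increasing coupling of the uniform trees, and
  by \<open>union_law_superset\<close> every other coupling has the same law of the union.\<close>
lemma critical_infinite_tree_law_eq_grown:
  assumes q: "0 \<le> q" "q \<le> 1/2"
  shows "critical_infinite_tree_law
    = distr randomness tree_space (\<lambda>u. \<Union>k\<in>{1..}. grown_tree q (enat k) u)"
  unfolding critical_infinite_tree_law_def
proof (rule the_equality)
  let ?N = "distr randomness tree_space (\<lambda>u. \<Union>k\<in>{1..}. grown_tree q (enat k) u)"
  let ?P = "\<Pi>\<^sub>M k\<in>(UNIV :: nat set). tree_space"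
  let ?f = "\<lambda>u k. grown_tree q (enat k) u"
  let ?M = "distr randomness ?P ?f"
  have f: "?f \<in> randomness \<rightarrow>\<^sub>M ?P"
    by (rule measurable_PiM_single') (use measurable_grown_tree grown_tree_subset_vertices in \<open>auto simp: space_PiM\<close>)
  have T: "(\<lambda>\<omega>. \<omega> k) \<in> ?P \<rightarrow>\<^sub>M tree_space" for k
    by (rule measurable_component_singleton) simp
  have "increasing_uniform_coupling ?M (\<lambda>k \<omega>. \<omega> k)"
    unfolding increasing_uniform_coupling_def
  proof (intro conjI allI impI)
    show M: "prob_space ?M" by (rule randomness.prob_space_distr[OF f])
    fix k :: nat assume "1 \<le> k"
    thus "has_law ?M (\<lambda>\<omega>. \<omega> k) (uniform_tree_law k)"
      using uniform_tree_law_eq_grown[OF q] by (intro has_law_distr f T) simp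
  next
    have M: "prob_space ?M" by (rule randomness.prob_space_distr[OF f])
    let ?G = "{\<omega> \<in> space ?P. \<forall>k\<ge>1. \<omega> k \<subseteq> \<omega> (Suc k)}"
    have "?G = {\<omega> \<in> space ?P. \<forall>k. \<omega> (Suc k) \<subseteq> \<omega> (Suc (Suc k))}"
      by (simp only: all_ge_1_iff)
    moreover have "\<dots> \<in> sets ?P"
      using measurable_tree_subset[OF T T] by (intro sets.sets_Collect_countable_All) (simp add: pred_def)
    ultimately have G: "?G \<in> sets ?P" by (simp only:)
    have "?f -` ?G \<inter> space randomness = space randomness"
      using measurable_space[OF f] grown_tree_mono[OF q(1) order.refl q(2)] by auto
    hence "emeasure ?M ?G = 1"
      unfolding emeasure_distr[OF f G] by (simp add: randomness.emeasure_space_1)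
    thus "measure ?M {\<omega> \<in> space ?M. \<forall>k\<ge>1. \<omega> k \<subseteq> \<omega> (Suc k)} = 1"
      by (simp add: measure_def)
  qed
  moreover have "has_law ?M (\<lambda>\<omega>. \<Union>k\<in>{1..}. \<omega> k) ?N"
    using T by (intro has_law_distr f measurable_Union_tree_space) auto
  ultimately have ex: "\<exists>(M :: (nat \<Rightarrow> vertex set) measure) T.
      increasing_uniform_coupling M T \<and> has_law M (\<lambda>\<omega>. \<Union>k\<in>{1..}. T k \<omega>) ?N"
    by (intro exI[of _ ?M] exI[of _ "\<lambda>k \<omega>. \<omega> k"] conjI)
  thus "\<exists>(M :: (nat \<Rightarrow> vertex set) measure) T.
      increasing_uniform_coupling M T \<and> has_law M (\<lambda>\<omega>. \<Union>k\<in>{1..}. T k \<omega>) ?N" .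
  fix N
  assume "\<exists>(M :: (nat \<Rightarrow> vertex set) measure) T.
      increasing_uniform_coupling M T \<and> has_law M (\<lambda>\<omega>. \<Union>k\<in>{1..}. T k \<omega>) N"
  then obtain M :: "(nat \<Rightarrow> vertex set) measure" and T
    where M: "increasing_uniform_coupling M T" "has_law M (\<lambda>\<omega>. \<Union>k\<in>{1..}. T k \<omega>) N" by blast
  from ex obtain M' :: "(nat \<Rightarrow> vertex set) measure" and T'
    where M': "increasing_uniform_coupling M' T'" "has_law M' (\<lambda>\<omega>. \<Union>k\<in>{1..}. T' k \<omega>) ?N" by blast
  show "N = ?N"
  proof (rule tree_measure_eqI)
    have "prob_space M" using M(1) by (simp add: increasing_uniform_coupling_def)
    hence "prob_space N" using M(2) prob_space.prob_space_distr[of M] by (auto simp: has_law_def)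
    thus "finite_measure N" by (rule prob_space.finite_measure)
    show "sets N = sets tree_space" using M(2) by (auto simp: has_law_def)
    fix A :: "vertex set" assume "finite A"
    thus "emeasure N {T \<in> space tree_space. A \<subseteq> T} = emeasure ?N {T \<in> space tree_space. A \<subseteq> T}"
      using union_law_superset[OF M] union_law_superset[OF M'] by simp
  qed simp
qed

section \<open>The coupling\<close>

theorem theorem1p2:
  fixes p1 p2 :: real
  assumes "1/2 \<le> p1" and "p1 < p2" and "p2 \<le> 1"
  shows "\<exists>(M :: (vertex set \<times> vertex set) measure) T1 T2.
    prob_space M \<and>
    has_law M T1 (infinite_tree_law p1) \<and>
    has_law M T2 (infinite_tree_law p2) \<and>
    measure M {\<omega> \<in> space M. T1 \<omega> \<subseteq> T2 \<omega>} = 1"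
proof -
  define q where "q = 1 - p2"
  have q: "0 \<le> q" "q \<le> 1/2" using assms by (auto simp: q_def)
  define t1 where "t1 = (if p1 = 1/2 then (\<lambda>u. \<Union>k\<in>{1..}. grown_tree q (enat k) u) else grown_tree (1 - p1) \<infinity>)"
  define t2 where "t2 = grown_tree q \<infinity>"
  have m1: "t1 \<in> randomness \<rightarrow>\<^sub>M tree_space"
    unfolding t1_def by (auto intro!: measurable_Union_tree_space measurable_grown_tree)
  have m2: "t2 \<in> randomness \<rightarrow>\<^sub>M tree_space" unfolding t2_def by (rule measurable_grown_tree)
  have law1: "distr randomness tree_space t1 = infinite_tree_law p1"
    using assms critical_infinite_tree_law_eq_grown[OF q] infinite_tree_law_eq_grown[of p1]
    by (auto simp: t1_def infinite_tree_law_def)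
  have law2: "distr randomness tree_space t2 = infinite_tree_law p2"
    using assms infinite_tree_law_eq_grown[of p2] by (simp add: t2_def q_def)
  have sub: "t1 u \<subseteq> t2 u" for u
  proof (cases "p1 = 1/2")
    case True
    have "grown_tree q (enat k) u \<subseteq> grown_tree q \<infinity> u" for k
      using q by (intro grown_tree_mono) auto
    thus ?thesis using True by (auto simp: t1_def t2_def)
  next
    case False
    thus ?thesis using assms q unfolding t1_def t2_def
      by (simp only: if_False) (intro grown_tree_mono, auto simp: q_def)
  qed
  let ?P = "tree_space \<Otimes>\<^sub>M tree_space"
  let ?f = "\<lambda>u. (t1 u, t2 u)"
  let ?M = "distr randomness ?P ?f"
  have f: "?f \<in> randomness \<rightarrow>\<^sub>M ?P" using m1 m2 by measurable
  have "has_law ?M fst (infinite_tree_law p1)" "has_law ?M snd (infinite_tree_law p2)"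
    using law1 law2 by (auto intro!: has_law_distr f)
  moreover have "measure ?M {\<omega> \<in> space ?M. fst \<omega> \<subseteq> snd \<omega>} = 1"
  proof -
    let ?G = "{\<omega> \<in> space ?P. fst \<omega> \<subseteq> snd \<omega>}"
    have G: "?G \<in> sets ?P"
      using measurable_tree_subset[OF measurable_fst measurable_snd] by (simp add: pred_def)
    have "?f -` ?G \<inter> space randomness = space randomness"
      using measurable_space[OF f] sub by auto
    hence "emeasure ?M ?G = 1"
      unfolding emeasure_distr[OF f G] by (simp add: randomness.emeasure_space_1)
    thus ?thesis by (simp add: measure_def)
  qed
  ultimately show ?thesis using randomness.prob_space_distr[OF f] by blast
qed

end
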